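(* Let $k,n$ be positive integers, let $G_{k,1}$ be a finite group with abelianization $C_k$ and commutator subgroup $H$, and let $G_{k,n}$ be its $n$-th central extension, with projection $\mathrm{pr}\colon G_{k,n}\to G_{k,1}$. Let $\rho_n\colon G_{k,n}\to\mathrm{GL}(kn|H|,\mathbb{Z})$ and $\rho_1\colon G_{k,1}\to\mathrm{GL}(k|H|,\mathbb{Z})$ be the regular representations, and put $\tilde\rho_1=\rho_1\circ\mathrm{pr}$. Let $K$ be an oriented knot in $S^3$ and suppose there exists an epimorphism $f_n\colon G(K)\to G_{k,n}$. Then $$\Delta_K^{\rho_n\circ f_n}(t)=\prod_{j=0}^{n-1}\Delta_K^{\tilde\rho_1\circ f_n}\big(e^{\frac{2\pi i}{kn}j}t\big),\qquad i=\sqrt{-1}.$$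
   Context: Central extensions: $C_m$ denotes the cyclic group of order $m$. Let $G_{k,1}$ be a finite group whose abelianization is $C_k=\langle\bar x\mid\bar x^k\rangle$ (such a group is the normal closure of one element), with abelianization map $\pi\colon G_{k,1}\to C_k$ and $H=\ker\pi$ its commutator subgroup. Let $\pi_k\colon C_{kn}=\langle x\mid x^{kn}\rangle\to C_k$, $x\mapsto\bar x$, be the natural projection. The $n$-th central extension of $G_{k,1}$ is the pull-back $$G_{k,n}=\{(z,x^l)\in G_{k,1}\times C_{kn}\mid\pi(z)=\pi_k(x^l)\},$$ and $\mathrm{pr}\colon G_{k,n}\to G_{k,1}$ is the projection to the first component; its kernel is the central subgroup $\langle(e,x^k)\rangle\cong C_n$. Knot group: for an oriented knot $K\subset S^3$, $E_K=S^3\setminus\nu(K)$ is the complement of an open tubular neighborhood and $G(K)=\pi_1(E_K)$. Let $\phi\colon G(K)\to\mathbb{Z}=\langle t\rangle$ be the abelianization, sending an oriented meridian to $t$. Twisted Alexander polynomial (Wada): let $R$ be a Noetherian unique factorization domain with quotient field $Q$ and $\varrho\colon G(K)\to\mathrm{GL}(d,R)$ a representation. Fix a Wirtinger presentation $G(K)=\langle s_1,\dots,s_m\mid r_1,\dots,r_{m-1}\rangle$. Extend $s\mapsto\phi(s)\varrho(s)$ to a ring homomorphism $\mathbb{Z}[G(K)]\to\mathrm{Mat}(d,R[t^{\pm1}])$, and let $\Phi\colon\mathbb{Z}[F_m]\to\mathrm{Mat}(d,R[t^{\pm1}])$ be its composition with the surjection $\mathbb{Z}[F_m]\to\mathbb{Z}[G(K)]$,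 where $F_m=\langle s_1,\dots,s_m\rangle$ is free. Let $M$ be the $d(m-1)\times dm$ matrix with blocks $\Phi(\partial r_i/\partial s_j)$ (Fox derivatives), and let $M_j$ be $M$ with the $j$-th block column removed. Then $\Delta_K^{\varrho}(t)=\det M_j/\det\Phi(s_j-1)\in Q(t)$, well defined up to multiplication by $\varepsilon t^l$ ($\varepsilon\in R^\times$, $l\in\mathbb{Z}$). Here the representations are regarded as complex representations ($R=\mathbb{C}$), and the equality is in $\mathbb{C}(t)$, understood up to multiplication by $\varepsilon t^l$ with $\varepsilon\in\mathbb{C}^\times$, $l\in\mathbb{Z}$. Regular representation: for a finite group $G$, the permutation representation on $\mathbb{Z}[G]$ given by the action of $G$ on itself by right multiplication (matrices acting on row vectors). *)

theory Defs
  imports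
    "HOL-Analysis.Analysis"
    "HOL-Algebra.Elementary_Groups"
    "HOL-Algebra.Generated_Groups"
    "HOL-Library.Poly_Mapping"
    "HOL-Computational_Algebra.Polynomial_Factorial"
    "HOL-Computational_Algebra.Field_as_Ring"
    "Jordan_Normal_Form.Determinant"
begin

section \<open>Groups\<close>

definition is_abelianization ::
    "('a, 'c) monoid_scheme \<Rightarrow> ('b, 'd) monoid_scheme \<Rightarrow> ('a \<Rightarrow> 'b) \<Rightarrow> bool" where
  "is_abelianization G A p \<longleftrightarrow>
     comm_group A \<and> p \<in> epi G A \<and> kernel G A p = derived G (carrier G)"

text \<open>Here \<open>C\<^sub>m\<close> is \<^const>\<open>integer_mod_group\<close>, the residue \<open>l\<close> standing for \<open>x\<^sup>l\<close>; hence the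
  projection \<open>C\<^sub>k\<^sub>n \<rightarrow> C\<^sub>k\<close> is \<open>l \<mapsto> l mod k\<close>.\<close>

definition central_extension ::
    "nat \<Rightarrow> nat \<Rightarrow> ('a, 'c) monoid_scheme \<Rightarrow> ('a \<Rightarrow> int) \<Rightarrow> ('a \<times> int) monoid" where
  "central_extension k n G p =
     (G \<times>\<times> integer_mod_group (k * n))
       \<lparr>carrier := {(z, l). z \<in> carrier G \<and> l \<in> carrier (integer_mod_group (k * n))
                            \<and> p z = l mod int k}\<rparr>"

text \<open>Matrices act on row vectors, so row \<open>a\<close> of the matrix of \<open>g\<close> has its \<open>1\<close> in column
  \<open>a g\<close>. The map \<open>e\<close> enumerates \<open>G\<close>.\<close>

definition regular_rep :: "('a, 'c) monoid_scheme \<Rightarrow> (nat \<Rightarrow> 'a) \<Rightarrow> 'a \<Rightarrow> int mat" where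
  "regular_rep G e g =
     Matrix.mat (order G) (order G) (\<lambda>(a, b). if e a \<otimes>\<^bsub>G\<^esub> g = e b then 1 else 0)"


section \<open>Free groups and presentations\<close>

text \<open>The letter \<open>(i, True)\<close> is the generator \<open>s\<^sub>i\<close> and \<open>(i, False)\<close> is its inverse. Elements of
  the free group are the freely reduced words.\<close>

type_synonym letter = "nat \<times> bool"

definition inv_letter :: "letter \<Rightarrow> letter" where
  "inv_letter x = (fst x, \<not> snd x)"

fun push_letter :: "letter \<Rightarrow> letter list \<Rightarrow> letter list" where
  "push_letter x [] = [x]"
| "push_letter x (y # w) = (if y = inv_letter x then w else x # y # w)"

definition free_reduce :: "letter list \<Rightarrow> letter list" where
  "free_reduce w = foldr push_letter w []"

definition free_group :: "nat \<Rightarrow> letter list monoid" where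
  "free_group m =
     \<lparr>carrier = {w. free_reduce w = w \<and> fst ` set w \<subseteq> {..<m}},
      monoid.mult = (\<lambda>u v. free_reduce (u @ v)), one = []\<rparr>"

definition normal_closure :: "('a, 'c) monoid_scheme \<Rightarrow> 'a set \<Rightarrow> 'a set" where
  "normal_closure G R = \<Inter>{N. N \<lhd> G \<and> R \<subseteq> N}"

definition word_value ::
    "('a, 'c) monoid_scheme \<Rightarrow> (nat \<Rightarrow> 'a) \<Rightarrow> letter list \<Rightarrow> 'a" where
  "word_value G s w =
     foldr (\<lambda>x g. (if snd x then s (fst x) else inv\<^bsub>G\<^esub> (s (fst x))) \<otimes>\<^bsub>G\<^esub> g) w \<one>\<^bsub>G\<^esub>"

text \<open>\<open>G = \<langle>s\<^sub>0, \<dots>, s\<^sub>m\<^sub>-\<^sub>1 | r\<^sub>0, \<dots>, r\<^sub>q\<^sub>-\<^sub>1\<rangle>\<close>\<close>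

definition group_presentation ::
    "('a, 'c) monoid_scheme \<Rightarrow> nat \<Rightarrow> (nat \<Rightarrow> 'a) \<Rightarrow> nat \<Rightarrow> (nat \<Rightarrow> letter list) \<Rightarrow> bool" where
  "group_presentation G m s q r \<longleftrightarrow>
     s ` {..<m} \<subseteq> carrier G \<and> r ` {..<q} \<subseteq> carrier (free_group m) \<and>
     word_value G s \<in> epi (free_group m) G \<and>
     kernel (free_group m) G (word_value G s) = normal_closure (free_group m) (r ` {..<q})"


section \<open>Knots\<close>

definition fundamental_group ::
    "'a::topological_space set \<Rightarrow> 'a \<Rightarrow> (real \<Rightarrow> 'a) set monoid" where
  "fundamental_group S x0 =
     \<lparr>carrier = {Collect (homotopic_paths S p) | p.
                   path p \<and> path_image p \<subseteq> S \<and> pathstart p = x0 \<and> pathfinish p = x0},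
      monoid.mult = (\<lambda>a b. {r. \<exists>p\<in>a. \<exists>q\<in>b. homotopic_paths S (p +++ q) r}),
      one = Collect (homotopic_paths S (\<lambda>_. x0))\<rparr>"

text \<open>An oriented knot is a \<open>C\<^sup>1\<close> embedding of the circle \<open>\<real>/\<int>\<close> in \<open>S\<^sup>3\<close>. Such knots are tame, and
  all smooth knots are among them.\<close>

definition oriented_knot :: "(real \<Rightarrow> real ^ 4) \<Rightarrow> bool" where
  "oriented_knot K \<longleftrightarrow>
     range K \<subseteq> sphere 0 1 \<and> (\<forall>t. K (t + 1) = K t) \<and> (\<forall>t u. K t = K u \<longrightarrow> t - u \<in> \<int>) \<and>
     (\<exists>K'. continuous_on UNIV K' \<and>
           (\<forall>t. (K has_vector_derivative K' t) (at t) \<and> K' t \<noteq> 0))"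

text \<open>A tubular neighbourhood is a \<open>C\<^sup>1\<close> embedding of the closed solid torus, with core \<open>K\<close>. The
  determinant condition says that the embedding is an immersion and preserves orientation, where
  \<open>S\<^sup>3\<close> is oriented as the boundary of the unit ball of \<open>\<real>\<^sup>4\<close>.\<close>

definition tubular_neighbourhood ::
    "(real \<Rightarrow> real ^ 4) \<Rightarrow> (real \<times> complex \<Rightarrow> real ^ 4) \<Rightarrow> bool" where
  "tubular_neighbourhood K T \<longleftrightarrow>
     (\<forall>t. T (t, 0) = K t) \<and>
     T ` (UNIV \<times> cball 0 1) \<subseteq> sphere 0 1 \<and>
     (\<forall>t. \<forall>z\<in>cball 0 1. T (t + 1, z) = T (t, z)) \<and>
     (\<forall>t u. \<forall>z\<in>cball 0 1. \<forall>w\<in>cball 0 1. T (t, z) = T (u, w) \<longrightarrow> t - u \<in> \<int> \<and> z = w) \<and>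
     (\<exists>T' :: real \<times> complex \<Rightarrow> (real \<times> complex) \<Rightarrow>\<^sub>L (real ^ 4).
        continuous_on (UNIV \<times> cball 0 1) T' \<and>
        (\<forall>p \<in> UNIV \<times> cball 0 1.
           (T has_derivative blinfun_apply (T' p)) (at p within UNIV \<times> cball 0 1) \<and>
           0 < Determinants.det (vector [T p, blinfun_apply (T' p) (1, 0),
                   blinfun_apply (T' p) (0, 1), blinfun_apply (T' p) (0, \<i>)] :: real ^ 4 ^ 4)))"

definition knot_exterior :: "(real \<times> complex \<Rightarrow> real ^ 4) \<Rightarrow> (real ^ 4) set" where
  "knot_exterior T = sphere 0 1 - T ` (UNIV \<times> ball 0 1)"

definition knot_group ::
    "(real \<times> complex \<Rightarrow> real ^ 4) \<Rightarrow> real ^ 4 \<Rightarrow> (real \<Rightarrow> real ^ 4) set monoid" where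
  "knot_group T x0 = fundamental_group (knot_exterior T) x0"

text \<open>Since \<open>T\<close> preserves orientation, these meridians have linking number \<open>+1\<close> with the knot.\<close>

definition oriented_meridian ::
    "(real \<times> complex \<Rightarrow> real ^ 4) \<Rightarrow> real ^ 4 \<Rightarrow> (real \<Rightarrow> real ^ 4) set \<Rightarrow> bool" where
  "oriented_meridian T x0 c \<longleftrightarrow>
     (\<exists>\<alpha> a. path \<alpha> \<and> path_image \<alpha> \<subseteq> knot_exterior T \<and> pathstart \<alpha> = x0 \<and>
            pathfinish \<alpha> = T (a, 1) \<and>
            c = Collect (homotopic_paths (knot_exterior T)
                  (\<alpha> +++ (\<lambda>\<theta>. T (a, cis (2 * pi * \<theta>))) +++ reversepath \<alpha>)))"

text \<open>The infinite cyclic group \<open>\<langle>t\<rangle>\<close> is written additively, so \<open>t\<close> is \<open>1\<close>.\<close>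

definition knot_abelianization ::
    "(real \<times> complex \<Rightarrow> real ^ 4) \<Rightarrow> real ^ 4 \<Rightarrow> ((real \<Rightarrow> real ^ 4) set \<Rightarrow> int) \<Rightarrow> bool" where
  "knot_abelianization T x0 \<phi> \<longleftrightarrow>
     is_abelianization (knot_group T x0) integer_group \<phi> \<and>
     (\<forall>c. oriented_meridian T x0 c \<longrightarrow> \<phi> c = 1)"

text \<open>A crossing with overpass \<open>s\<^sub>k\<close> and underpasses \<open>s\<^sub>i\<close>, \<open>s\<^sub>j\<close> gives
  \<open>s\<^sub>k\<^sup>\<epsilon> s\<^sub>i s\<^sub>k\<^sup>-\<^sup>\<epsilon> = s\<^sub>j\<close>. Turning this into a relator is possible in several ways, all of which
  are covered by cyclic rotation and exchanging \<open>i\<close> and \<open>j\<close>. At a kink the word may fail to be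
  reduced.\<close>

definition wirtinger_relator :: "nat \<Rightarrow> letter list \<Rightarrow> bool" where
  "wirtinger_relator m w \<longleftrightarrow>
     (\<exists>i<m. \<exists>j<m. \<exists>k<m. \<exists>\<epsilon> l.
        w = free_reduce (rotate l [(k, \<epsilon>), (i, True), (k, \<not> \<epsilon>), (j, False)]))"

text \<open>A presentation of the knot group by oriented meridians and one relator fewer, all of them
  crossing relators. The presentations read off from diagrams of the knot have this form.\<close>

definition wirtinger_presentation ::
    "(real \<times> complex \<Rightarrow> real ^ 4) \<Rightarrow> real ^ 4 \<Rightarrow>
     nat \<Rightarrow> (nat \<Rightarrow> (real \<Rightarrow> real ^ 4) set) \<Rightarrow> (nat \<Rightarrow> letter list) \<Rightarrow> bool" where
  "wirtinger_presentation T x0 m s r \<longleftrightarrow>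
     0 < m \<and> (\<forall>i<m. oriented_meridian T x0 (s i)) \<and> (\<forall>i<m - 1. wirtinger_relator m (r i)) \<and>
     group_presentation (knot_group T x0) m s (m - 1) r"


section \<open>Twisted Alexander polynomials\<close>

text \<open>The integral group ring of a group with elements of type \<open>'a\<close> is \<open>'a \<Rightarrow>\<^sub>0 int\<close>, with
  \<^term>\<open>frag_of g\<close> the basis element belonging to \<open>g\<close>.\<close>

text \<open>Fox derivative with respect to \<open>s\<^sub>j\<close>, by
  \<open>\<partial>(x w) = \<partial>x + x \<partial>w\<close> and \<open>\<partial>(s\<^sub>j\<^sup>-\<^sup>1) = - s\<^sub>j\<^sup>-\<^sup>1\<close>.\<close>

definition fox_letter :: "nat \<Rightarrow> letter \<Rightarrow> letter list \<Rightarrow>\<^sub>0 int" where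
  "fox_letter j x =
     (if fst x \<noteq> j then 0 else if snd x then frag_of [] else - frag_of [x])"

primrec fox :: "nat \<Rightarrow> letter list \<Rightarrow> letter list \<Rightarrow>\<^sub>0 int" where
  "fox j [] = 0"
| "fox j (x # w) = fox_letter j x + frag_extend (\<lambda>v. frag_of (free_reduce (x # v))) (fox j w)"

text \<open>\<open>Q(t)\<close>, for \<open>Q\<close> the quotient field of \<open>R\<close>, is realised as the fraction field of \<open>R[t]\<close>; it
  contains the Laurent polynomial ring.\<close>

definition const_ratfun :: "'r::idom \<Rightarrow> 'r poly fract" where
  "const_ratfun c = Fract [:c:] 1"

definition t_ratfun :: "'r::idom poly fract" where
  "t_ratfun = Fract [:0, 1:] 1"

definition group_ring_rep ::
    "nat \<Rightarrow> ('a \<Rightarrow> int) \<Rightarrow> ('a \<Rightarrow> 'r::idom mat) \<Rightarrow> ('a \<Rightarrow>\<^sub>0 int) \<Rightarrow> 'r poly fract mat" where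
  "group_ring_rep d \<phi> \<rho> a =
     Matrix.mat d d (\<lambda>(p, q). \<Sum>g \<in> Poly_Mapping.keys a.
       of_int (Poly_Mapping.lookup a g) * (t_ratfun powi \<phi> g * const_ratfun (\<rho> g $$ (p, q))))"

definition wada_Phi ::
    "nat \<Rightarrow> ('a, 'c) monoid_scheme \<Rightarrow> (nat \<Rightarrow> 'a) \<Rightarrow> ('a \<Rightarrow> int) \<Rightarrow> ('a \<Rightarrow> 'r::idom mat) \<Rightarrow>
     (letter list \<Rightarrow>\<^sub>0 int) \<Rightarrow> 'r poly fract mat" where
  "wada_Phi d G s \<phi> \<rho> a =
     group_ring_rep d \<phi> \<rho> (frag_extend (\<lambda>w. frag_of (word_value G s w)) a)"

definition alexander_matrix ::
    "nat \<Rightarrow> ('a, 'c) monoid_scheme \<Rightarrow> nat \<Rightarrow> (nat \<Rightarrow> 'a) \<Rightarrow> (nat \<Rightarrow> letter list) \<Rightarrow>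
     ('a \<Rightarrow> int) \<Rightarrow> ('a \<Rightarrow> 'r::idom mat) \<Rightarrow> 'r poly fract mat" where
  "alexander_matrix d G m s r \<phi> \<rho> =
     Matrix.mat (d * (m - 1)) (d * m)
       (\<lambda>(p, q). wada_Phi d G s \<phi> \<rho> (fox (q div d) (r (p div d))) $$ (p mod d, q mod d))"

definition delete_block_col :: "nat \<Rightarrow> nat \<Rightarrow> 'x mat \<Rightarrow> 'x mat" where
  "delete_block_col d j M =
     Matrix.mat (dim_row M) (dim_col M - d)
       (\<lambda>(p, q). M $$ (p, if q < d * j then q else q + d))"

text \<open>The representative of Wada's invariant obtained from the given presentation and the choice
  of the \<open>j\<close>-th generator.\<close>

definition twisted_alexander ::
    "nat \<Rightarrow> ('a, 'c) monoid_scheme \<Rightarrow> nat \<Rightarrow> (nat \<Rightarrow> 'a) \<Rightarrow> (nat \<Rightarrow> letter list) \<Rightarrow>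
     ('a \<Rightarrow> int) \<Rightarrow> ('a \<Rightarrow> 'r::idom mat) \<Rightarrow> nat \<Rightarrow> 'r poly fract" where
  "twisted_alexander d G m s r \<phi> \<rho> j =
     Determinant.det (delete_block_col d j (alexander_matrix d G m s r \<phi> \<rho>)) /
     Determinant.det (wada_Phi d G s \<phi> \<rho> (frag_of [(j, True)] - frag_of []))"

definition eq_up_to_units :: "'r::idom poly fract \<Rightarrow> 'r poly fract \<Rightarrow> bool" where
  "eq_up_to_units F G \<longleftrightarrow> (\<exists>\<epsilon> l. \<epsilon> dvd 1 \<and> F = const_ratfun \<epsilon> * t_ratfun powi l * G)"

text \<open>\<open>F(t) \<mapsto> F(c t)\<close>\<close>

definition rescale_var :: "complex \<Rightarrow> complex poly fract \<Rightarrow> complex poly fract" where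
  "rescale_var c F = (case quot_of_fract F of (p, q) \<Rightarrow> Fract (p \<circ>\<^sub>p [:0, c:]) (q \<circ>\<^sub>p [:0, c:]))"


section \<open>Free groups and fundamental groups are groups\<close>

lemma inv_letter_inv [simp]: "inv_letter (inv_letter x) = x"
  by (simp add: inv_letter_def)

lemma free_reduce_Nil [simp]: "free_reduce [] = []"
  and free_reduce_Cons: "free_reduce (x # w) = push_letter x (free_reduce w)"
  by (simp_all add: free_reduce_def)

lemma length_push_letter: "length (push_letter x w) \<le> Suc (length w)"
  by (cases w) auto

lemma length_free_reduce: "length (free_reduce w) \<le> length w"
proof (induction w)
  case (Cons x w)
  then show ?case using length_push_letter[of x "free_reduce w"] by (simp add: free_reduce_Cons)
qed simp

lemma free_reduce_ConsD: assumes "free_reduce (x # w) = x # w" shows "free_reduce w = w"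
proof -
  have "push_letter x (free_reduce w) = x # w" using assms by (simp add: free_reduce_Cons)
  then have "free_reduce w = w \<or> length (free_reduce w) = Suc (length (x # w))"
    by (cases "free_reduce w") (auto split: if_splits)
  then show ?thesis using length_free_reduce[of w] by auto
qed

lemma free_reduce_push: "free_reduce w = w \<Longrightarrow> free_reduce (push_letter x w) = push_letter x w"
proof (cases w)
  case (Cons y v)
  assume w: "free_reduce w = w"
  show ?thesis
  proof (cases "y = inv_letter x")
    case True
    then show ?thesis using free_reduce_ConsD[of y v] w Cons by simp
  next
    case False
    then have "push_letter x w = x # w" using Cons by simp
    then show ?thesis using w by (simp add: free_reduce_Cons)
  qed
qed (simp add: free_reduce_Cons)

lemma free_reduce_idem [simp]: "free_reduce (free_reduce w) = free_reduce w"
  by (induction w) (auto simp: free_reduce_Cons free_reduce_push)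

lemma push_push: assumes "free_reduce w = w" shows "push_letter x (push_letter (inv_letter x) w) = w"
proof (cases w)
  case (Cons y v)
  show ?thesis
  proof (cases "y = x")
    case True
    then show ?thesis using Cons assms free_reduce_ConsD[of y v]
      by (auto simp: free_reduce_Cons)
  qed (use Cons in auto)
qed auto

lemma free_reduce_push_append:
  "free_reduce (push_letter x u @ w) = push_letter x (free_reduce (u @ w))"
proof (cases u)
  case (Cons y v)
  then show ?thesis using push_push[of "free_reduce (v @ w)" x] by (auto simp: free_reduce_Cons)
qed (auto simp: free_reduce_Cons)

lemma free_reduce_append_left: "free_reduce (free_reduce u @ w) = free_reduce (u @ w)"
  by (induction u) (auto simp: free_reduce_Cons free_reduce_push_append)

lemma free_reduce_append_right: "free_reduce (u @ free_reduce w) = free_reduce (u @ w)"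
  by (induction u) (auto simp: free_reduce_Cons)

lemma set_free_reduce: "set (free_reduce w) \<subseteq> set w"
proof (induction w)
  case (Cons x w)
  have "set (push_letter x v) \<subseteq> insert x (set v)" for v by (cases v) auto
  then show ?case using Cons by (fastforce simp: free_reduce_Cons)
qed simp

lemma free_reduce_inverse: "free_reduce (map inv_letter (rev w) @ w) = []"
proof (induction w)
  case (Cons x w)
  have "free_reduce (map inv_letter (rev (x # w)) @ x # w)
      = free_reduce (map inv_letter (rev w) @ free_reduce ([inv_letter x] @ [x] @ w))"
    by (simp add: free_reduce_append_right)
  also have "free_reduce ([inv_letter x] @ [x] @ w) = free_reduce w"
    using push_push[of "free_reduce w" "inv_letter x"] by (simp add: free_reduce_Cons)
  finally show ?case using Cons by (simp add: free_reduce_append_right)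
qed simp

lemma group_free_group: "group (free_group m)"
proof (rule groupI)
  fix u v w assume "u \<in> carrier (free_group m)" "v \<in> carrier (free_group m)" "w \<in> carrier (free_group m)"
  then show "u \<otimes>\<^bsub>free_group m\<^esub> v \<otimes>\<^bsub>free_group m\<^esub> w = u \<otimes>\<^bsub>free_group m\<^esub> (v \<otimes>\<^bsub>free_group m\<^esub> w)"
    by (simp add: free_group_def free_reduce_append_left free_reduce_append_right)
next
  fix w assume w: "w \<in> carrier (free_group m)"
  have "free_reduce (map inv_letter (rev w)) \<in> carrier (free_group m)"
    using w set_free_reduce[of "map inv_letter (rev w)"] by (fastforce simp: free_group_def inv_letter_def)
  moreover have "free_reduce (map inv_letter (rev w)) \<otimes>\<^bsub>free_group m\<^esub> w = \<one>\<^bsub>free_group m\<^esub>"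
    by (simp add: free_group_def free_reduce_append_left free_reduce_inverse)
  ultimately show "\<exists>v\<in>carrier (free_group m). v \<otimes>\<^bsub>free_group m\<^esub> w = \<one>\<^bsub>free_group m\<^esub>" by blast
qed (use set_free_reduce in \<open>fastforce simp: free_group_def\<close>)+

lemma homotopy_class_eq: "homotopic_paths S p q \<Longrightarrow> Collect (homotopic_paths S p) = Collect (homotopic_paths S q)"
  by (auto intro: homotopic_paths_trans homotopic_paths_sym)

lemma fundamental_group_mult:
  assumes "path p" "path_image p \<subseteq> S" "path q" "path_image q \<subseteq> S" "pathfinish p = pathstart q"
  shows "Collect (homotopic_paths S p) \<otimes>\<^bsub>fundamental_group S x\<^esub> Collect (homotopic_paths S q)
       = Collect (homotopic_paths S (p +++ q))"
proof -
  have "homotopic_paths S (p +++ q) r \<longleftrightarrow>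
      (\<exists>p'. homotopic_paths S p p' \<and> (\<exists>q'. homotopic_paths S q q' \<and> homotopic_paths S (p' +++ q') r))"
    (is "?L \<longleftrightarrow> ?R") for r
  proof
    assume ?L
    then show ?R using assms by (intro exI[of _ p] exI[of _ q] conjI) simp_all
  next
    assume ?R
    then obtain p' q' where pq: "homotopic_paths S p p'" "homotopic_paths S q q'"
      "homotopic_paths S (p' +++ q') r" by blast
    show ?L
      by (rule homotopic_paths_trans[OF homotopic_paths_join[OF pq(1,2) assms(5)] pq(3)])
  qed
  note eq = this
  show ?thesis by (rule Set.set_eqI) (simp add: fundamental_group_def eq)
qed

definition loop_in :: "'a::topological_space set \<Rightarrow> 'a \<Rightarrow> (real \<Rightarrow> 'a) \<Rightarrow> bool" where
  "loop_in S x p \<longleftrightarrow> path p \<and> path_image p \<subseteq> S \<and> pathstart p = x \<and> pathfinish p = x"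

lemma carrier_fundamental_group:
  "carrier (fundamental_group S x) = {Collect (homotopic_paths S p) |p. loop_in S x p}"
  by (simp add: fundamental_group_def loop_in_def)

lemma fundamental_group_mult_loops:
  "loop_in S x p \<Longrightarrow> loop_in S x q \<Longrightarrow>
   Collect (homotopic_paths S p) \<otimes>\<^bsub>fundamental_group S x\<^esub> Collect (homotopic_paths S q) = Collect (homotopic_paths S (p +++ q))"
  by (rule fundamental_group_mult) (auto simp: loop_in_def)

lemma loop_in_join: "loop_in S x p \<Longrightarrow> loop_in S x q \<Longrightarrow> loop_in S x (p +++ q)"
  unfolding loop_in_def by (auto intro!: path_join_imp simp: subset_path_image_join)

lemma group_fundamental_group:
  fixes x :: "'a::real_normed_vector"
  assumes "x \<in> S" shows "group (fundamental_group S x)"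
proof -
  have one: "\<one>\<^bsub>fundamental_group S x\<^esub> = Collect (homotopic_paths S (linepath x x))"
    by (simp add: fundamental_group_def linepath_refl)
  have lp1: "loop_in S x (linepath x x)" using assms by (simp add: loop_in_def)
  show ?thesis
  proof (rule groupI)
    fix a b assume "a \<in> carrier (fundamental_group S x)" "b \<in> carrier (fundamental_group S x)"
    then show "a \<otimes>\<^bsub>fundamental_group S x\<^esub> b \<in> carrier (fundamental_group S x)"
      by (auto simp: carrier_fundamental_group fundamental_group_mult_loops intro: loop_in_join)
  next
    show "\<one>\<^bsub>fundamental_group S x\<^esub> \<in> carrier (fundamental_group S x)"
      using lp1 by (auto simp: carrier_fundamental_group one)
  next
    fix a b c
    assume "a \<in> carrier (fundamental_group S x)" "b \<in> carrier (fundamental_group S x)"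
      "c \<in> carrier (fundamental_group S x)"
    then obtain p q r where abc: "a = Collect (homotopic_paths S p)"
      "b = Collect (homotopic_paths S q)" "c = Collect (homotopic_paths S r)"
      and l: "loop_in S x p" "loop_in S x q" "loop_in S x r"
      by (auto simp: carrier_fundamental_group)
    have "homotopic_paths S (p +++ (q +++ r)) ((p +++ q) +++ r)"
      using l by (intro homotopic_paths_assoc) (auto simp: loop_in_def)
    then show "a \<otimes>\<^bsub>fundamental_group S x\<^esub> b \<otimes>\<^bsub>fundamental_group S x\<^esub> c =
      a \<otimes>\<^bsub>fundamental_group S x\<^esub> (b \<otimes>\<^bsub>fundamental_group S x\<^esub> c)"
      by (simp only: abc fundamental_group_mult_loops l loop_in_join homotopy_class_eq)
  next
    fix a assume "a \<in> carrier (fundamental_group S x)"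
    then obtain p where p: "a = Collect (homotopic_paths S p)" "loop_in S x p" by (auto simp: carrier_fundamental_group)
    show "\<one>\<^bsub>fundamental_group S x\<^esub> \<otimes>\<^bsub>fundamental_group S x\<^esub> a = a"
      using p lp1 homotopic_paths_lid[of p S] by (auto simp: one fundamental_group_mult_loops loop_in_def intro!: homotopy_class_eq)
    have "loop_in S x (reversepath p)" using p by (simp add: loop_in_def)
    moreover have "Collect (homotopic_paths S (reversepath p +++ p)) = Collect (homotopic_paths S (linepath x x))"
      using homotopic_paths_linv[of p S] p by (intro homotopy_class_eq) (simp add: loop_in_def)
    ultimately have "Collect (homotopic_paths S (reversepath p)) \<in> carrier (fundamental_group S x)"
      "Collect (homotopic_paths S (reversepath p)) \<otimes>\<^bsub>fundamental_group S x\<^esub> a = \<one>\<^bsub>fundamental_group S x\<^esub>"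
      using p by (auto simp: carrier_fundamental_group one fundamental_group_mult_loops)
    then show "\<exists>b\<in>carrier (fundamental_group S x). b \<otimes>\<^bsub>fundamental_group S x\<^esub> a = \<one>\<^bsub>fundamental_group S x\<^esub>" by blast
  qed
qed

end

theory Submission
  imports Defs
begin

text \<open>Why n factors suffice although the roots have order kn: C_n is generated by x^k, and
  with zeta = e^(2 pi i / kn) the character x -> zeta^j of C_kn sends x^k to zeta^(kj), a power of
  the primitive n-th root of unity zeta^k. Hence j = 0, ..., n-1 restrict to every character of C_n
  exactly once. Extending a character of C_n to C_kn in another way changes it by a character of
  C_k, and tensoring with such a character leaves the regular representation of the smaller group
  unchanged up to isomorphism. The splitting is carried out by one explicit matrix, a finite Fourier
  transform along the fibres of the projection. It is invertible by orthogonality of characters, and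
  its entries are constants, so the variable t passes through the change of basis.\<close>

text \<open>The group algebra of \<open>G\<^sub>k\<^sub>,\<^sub>n\<close> splits under the central subgroup \<open>C\<^sub>n\<close> into its isotypic parts. The
  character of \<open>C\<^sub>n\<close> belonging to a part extends to a character of \<open>G\<^sub>k\<^sub>,\<^sub>n\<close> through the projection to
  \<open>C\<^sub>k\<^sub>n\<close>, so the part is \<open>\<rho>\<^sub>1 \<circ> pr\<close> twisted by this character. On the knot group the twist factors
  through \<open>\<phi>\<close> and therefore only replaces \<open>t\<close> by a multiple of \<open>t\<close>. Conjugating a representation
  leaves Wada's quotient unchanged, and a direct sum gives a product of quotients. Independence of the
  deleted generator comes from the fundamental formula of Fox calculus. As everything is only needed up to
  units, determinants are indexed by arbitrary finite sets and compared up to sign.\<close>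

section \<open>Determinants over finite index sets, up to sign\<close>

text \<open>Each step of the argument loses at most a sign, so the unit in the final formula is 1 or
  -1 and no power of t appears.\<close>

definition sgn_eq :: "'f::ring_1 \<Rightarrow> 'f \<Rightarrow> bool" (infix "\<simeq>" 50) where
  "x \<simeq> y \<longleftrightarrow> x = y \<or> x = - y"

lemma sgn_eq_refl [simp, intro]: "x \<simeq> x"
  by (simp add: sgn_eq_def)

lemma sgn_eq_sym: "x \<simeq> y \<Longrightarrow> y \<simeq> x"
  by (auto simp: sgn_eq_def)

lemma sgn_eq_trans [trans]: "x \<simeq> y \<Longrightarrow> y \<simeq> z \<Longrightarrow> x \<simeq> z"
  by (auto simp: sgn_eq_def)

lemma sgn_eq_mult: "x \<simeq> x' \<Longrightarrow> y \<simeq> y' \<Longrightarrow> x * y \<simeq> x' * y'"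
  by (auto simp: sgn_eq_def)

lemma sgn_eq_divide:
  fixes x y :: "'f::field"
  shows "x \<simeq> x' \<Longrightarrow> y \<simeq> y' \<Longrightarrow> x / y \<simeq> x' / y'"
  by (auto simp: sgn_eq_def)

lemma sgn_eq_prod:
  fixes f g :: "'s \<Rightarrow> 'f::comm_ring_1"
  shows "(\<And>s. s \<in> S \<Longrightarrow> f s \<simeq> g s) \<Longrightarrow> prod f S \<simeq> prod g S"
  by (induction S rule: infinite_finite_induct) (auto intro: sgn_eq_mult)

lemma sgn_eq_signof: "signof p * x \<simeq> (x :: 'f::comm_ring_1)"
  by (cases p rule: sign_cases) (auto simp: sgn_eq_def)

lemma bij_betw_change_enum:
  fixes e e' :: "nat \<Rightarrow> 'i"
  assumes "bij_betw e {..<N} I" "bij_betw e' {..<N} I"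
  obtains p where "p permutes {0..<N}" "\<And>a. a < N \<Longrightarrow> e (p a) = e' a"
proof
  let ?p = "\<lambda>a. if a < N then the_inv_into {..<N} e (e' a) else a"
  have "bij_betw (the_inv_into {..<N} e \<circ> e') {..<N} {..<N}"
    using assms by (intro bij_betw_trans[OF assms(2)] bij_betw_the_inv_into)
  then have "bij_betw ?p {..<N} {..<N}"
    by (subst bij_betw_cong[where g = "the_inv_into {..<N} e \<circ> e'"]) auto
  then show "?p permutes {0..<N}"
    by (intro bij_imp_permutes) (auto simp: atLeast0LessThan)
  show "e (?p a) = e' a" if "a < N" for a
  proof -
    have "e' a \<in> e ` {..<N}" using assms that by (auto simp: bij_betw_def)
    then show ?thesis
      using that assms(1) by (simp add: f_the_inv_into_f bij_betw_def)
  qed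
qed

lemma det_change_enum:
  fixes A :: "'i \<Rightarrow> 'j \<Rightarrow> 'f::comm_ring_1"
  assumes "bij_betw e {..<N} I" "bij_betw e' {..<N} I" "bij_betw c {..<N} J" "bij_betw c' {..<N} J"
  shows "Determinant.det (Matrix.mat N N (\<lambda>(a, b). A (e a) (c b)))
       \<simeq> Determinant.det (Matrix.mat N N (\<lambda>(a, b). A (e' a) (c' b)))"
proof -
  obtain p where p: "p permutes {0..<N}" "\<And>a. a < N \<Longrightarrow> e (p a) = e' a"
    by (rule bij_betw_change_enum[OF assms(1,2)]) blast
  obtain q where q: "q permutes {0..<N}" "\<And>a. a < N \<Longrightarrow> c (q a) = c' a"
    by (rule bij_betw_change_enum[OF assms(3,4)]) blast
  have pq: "p a < N" "q a < N" if "a < N" for a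
    using permutes_in_image[OF p(1), of a] permutes_in_image[OF q(1), of a] that by auto
  let ?M = "Matrix.mat N N (\<lambda>(a, b). A (e a) (c b))"
  let ?M1 = "Matrix.mat N N (\<lambda>(a, b). ?M $$ (p a, b))"
  \<comment> \<open>Columns are permuted as rows of the transpose.\<close>
  let ?M2 = "Matrix.mat N N (\<lambda>(a, b). transpose_mat ?M1 $$ (q a, b))"
  have "Determinant.det ?M2 = signof q * (signof p * Determinant.det ?M)"
    using det_permute_rows[of "transpose_mat ?M1" N q] det_permute_rows[of ?M N p] p q
    by (simp add: det_transpose[of ?M1 N])
  moreover have "transpose_mat ?M2 = Matrix.mat N N (\<lambda>(a, b). A (e' a) (c' b))"
    by (rule eq_matI) (auto simp: p q pq)
  then have "Determinant.det ?M2 = Determinant.det (Matrix.mat N N (\<lambda>(a, b). A (e' a) (c' b)))"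
    using det_transpose[of ?M2 N] by simp
  ultimately have "Determinant.det (Matrix.mat N N (\<lambda>(a, b). A (e' a) (c' b))) \<simeq> Determinant.det ?M"
    using sgn_eq_trans[OF sgn_eq_signof sgn_eq_signof] by simp
  then show ?thesis
    by (rule sgn_eq_sym)
qed

definition enum_of :: "'i set \<Rightarrow> nat \<Rightarrow> 'i" where
  "enum_of I = (SOME e. bij_betw e {..<card I} I)"

lemma bij_betw_enum_of: "finite I \<Longrightarrow> bij_betw (enum_of I) {..<card I} I"
  using someI_ex[of "\<lambda>e. bij_betw e {..<card I} I"] ex_bij_betw_nat_finite[of I]
  by (simp add: enum_of_def atLeast0LessThan)

text \<open>The enumerations are arbitrary, so only the class of this determinant up to sign is meaningful.\<close>

definition idet :: "'i set \<Rightarrow> 'j set \<Rightarrow> ('i \<Rightarrow> 'j \<Rightarrow> 'f) \<Rightarrow> 'f::comm_ring_1" where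
  "idet I J A = Determinant.det (Matrix.mat (card I) (card J) (\<lambda>(a, b). A (enum_of I a) (enum_of J b)))"

text \<open>This is how the matrices of \<open>twisted_alexander\<close>, whose numbering encodes
  block and position in one number, are compared with determinants indexed by pairs.\<close>

lemma idet_enum:
  assumes "bij_betw e {..<N} I" "bij_betw c {..<N} J"
  shows "Determinant.det (Matrix.mat N N (\<lambda>(a, b). A (e a) (c b))) \<simeq> idet I J A"
proof -
  have card: "card I = N" "card J = N"
    using bij_betw_same_card[OF assms(1)] bij_betw_same_card[OF assms(2)] by simp_all
  have "finite I" "finite J"
    using bij_betw_finite[OF assms(1)] bij_betw_finite[OF assms(2)] by simp_all
  then have "bij_betw (enum_of I) {..<N} I" "bij_betw (enum_of J) {..<N} J"
    using bij_betw_enum_of card by metis+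
  then show ?thesis
    unfolding idet_def card by (intro det_change_enum[OF assms(1) _ assms(2)])
qed

lemma idet_cong:
  assumes "finite I" "finite J" "\<And>i j. i \<in> I \<Longrightarrow> j \<in> J \<Longrightarrow> A i j = B i j"
  shows "idet I J A = idet I J B"
proof -
  have "enum_of I a \<in> I" if "a < card I" for a
    using bij_betw_enum_of[OF assms(1)] that by (auto simp: bij_betw_def)
  moreover have "enum_of J a \<in> J" if "a < card J" for a
    using bij_betw_enum_of[OF assms(2)] that by (auto simp: bij_betw_def)
  ultimately show ?thesis
    unfolding idet_def
    by (intro arg_cong[where f = Determinant.det] eq_matI) (auto simp: assms(3))
qed

lemma idet_hom:
  assumes "comm_ring_hom h"
  shows "h (idet I J A) = idet I J (\<lambda>i j. h (A i j))"
proof -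
  let ?M = "\<lambda>A. Matrix.mat (card I) (card J) (\<lambda>(a, b). A (enum_of I a) (enum_of J b))"
  have "?M (\<lambda>i j. h (A i j)) = map_mat h (?M A)"
    by (rule eq_matI) simp_all
  then show ?thesis
    using comm_ring_hom.hom_det[OF assms, of "?M A"] by (simp only: idet_def)
qed

lemma idet_reindex:
  assumes "finite I'" "finite J'" "card I' = card J'" "bij_betw f I' I" "bij_betw g J' J"
  shows "idet I J A \<simeq> idet I' J' (\<lambda>i j. A (f i) (g j))"
proof -
  let ?N = "card I'"
  have "bij_betw (enum_of I') {..<?N} I'" "bij_betw (enum_of J') {..<?N} J'"
    using bij_betw_enum_of assms by metis+
  then have "bij_betw (f \<circ> enum_of I') {..<?N} I" "bij_betw (g \<circ> enum_of J') {..<?N} J"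
    using assms by (auto intro: bij_betw_trans)
  from idet_enum[OF this, of A] show ?thesis
    by (auto simp: idet_def assms(3) intro: sgn_eq_sym)
qed

text \<open>Both factors use the same enumeration of \<open>J\<close>, so the arbitrary choice
  cancels and multiplicativity is exact. The three index sets may have different types, as is needed
  for a change of basis.\<close>

lemma idet_mult:
  assumes "finite J" "card I = card J" "card J = card L"
  shows "idet I J A * idet J L B = idet I L (\<lambda>i l. \<Sum>j\<in>J. A i j * B j l)"
proof -
  let ?N = "card J"
  let ?A = "Matrix.mat ?N ?N (\<lambda>(a, b). A (enum_of I a) (enum_of J b))"
  let ?B = "Matrix.mat ?N ?N (\<lambda>(a, b). B (enum_of J a) (enum_of L b))"
  have "(\<Sum>j\<in>J. A i j * B j l) = (\<Sum>a<?N. A i (enum_of J a) * B (enum_of J a) l)" for i l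
    by (rule sum.reindex_bij_betw[OF bij_betw_enum_of[OF assms(1)], symmetric])
  then have "?A * ?B = Matrix.mat ?N ?N (\<lambda>(a, b). \<Sum>j\<in>J. A (enum_of I a) j * B j (enum_of L b))"
    by (intro eq_matI) (auto simp: scalar_prod_def atLeast0LessThan)
  moreover have "Determinant.det (?A * ?B) = Determinant.det ?A * Determinant.det ?B"
    by (rule det_mult[of _ ?N]) auto
  ultimately show ?thesis
    using assms by (simp add: idet_def)
qed

lemma idet_id:
  assumes "finite I"
  shows "idet I I (\<lambda>i j. if i = j then 1 else 0 :: 'f::comm_ring_1) = 1"
proof -
  have "Matrix.mat (card I) (card I) (\<lambda>(a, b). if enum_of I a = enum_of I b then 1 else 0 :: 'f)
      = 1\<^sub>m (card I)"
    using bij_betw_enum_of[OF assms]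
    by (intro eq_matI) (auto simp: bij_betw_def dest: inj_onD)
  then show ?thesis
    by (simp add: idet_def)
qed

lemma idet_empty: "idet {} {} A = 1"
  by (simp add: idet_def Determinant.det_def)

lemma bij_betw_append_enum:
  fixes N M :: nat
  assumes "bij_betw e {..<N} I" "bij_betw c {..<M} J" "I \<inter> J = {}"
  shows "bij_betw (\<lambda>a. if a < N then e a else c (a - N)) {..<N + M} (I \<union> J)"
proof -
  have "bij_betw (\<lambda>a. if a < N then e a else c (a - N)) {..<N} I"
    using assms(1) by (subst bij_betw_cong[where g = e]) auto
  moreover have "bij_betw (\<lambda>a. if a < N then e a else c (a - N)) {N..<N + M} J"
  proof -
    have "bij_betw (\<lambda>a. a - N) {N..<N + M} {..<M}"
      by (rule bij_betw_byWitness[where f' = "\<lambda>a. a + N"]) auto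
    from bij_betw_trans[OF this assms(2)] show ?thesis
      by (subst bij_betw_cong[where g = "c \<circ> (\<lambda>a. a - N)"]) auto
  qed
  ultimately have "bij_betw (\<lambda>a. if a < N then e a else c (a - N)) ({..<N} \<union> {N..<N + M}) (I \<union> J)"
    using assms(3) by (rule bij_betw_combine)
  moreover have "{..<N} \<union> {N..<N + M} = {..<N + M}" by auto
  ultimately show ?thesis by simp
qed

text \<open>Listing \<open>I\<close> before \<open>I'\<close> and \<open>J\<close> before
  \<open>J'\<close> makes the matrix block upper triangular. The size conditions ensure that the
  diagonal blocks are square.\<close>

lemma idet_block:
  fixes A :: "'i \<Rightarrow> 'j \<Rightarrow> 'f::idom"
  assumes "finite I" "finite I'" "finite J" "finite J'" "I \<inter> I' = {}" "J \<inter> J' = {}"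
    and card: "card I = card J" "card I' = card J'"
    and zero: "\<And>i j. i \<in> I' \<Longrightarrow> j \<in> J \<Longrightarrow> A i j = 0"
  shows "idet (I \<union> I') (J \<union> J') A \<simeq> idet I J A * idet I' J' A"
proof -
  let ?N = "card J" and ?M = "card J'"
  note b = bij_betw_enum_of
  let ?e = "\<lambda>a. if a < ?N then enum_of I a else enum_of I' (a - ?N)"
  let ?c = "\<lambda>a. if a < ?N then enum_of J a else enum_of J' (a - ?N)"
  have e: "bij_betw (enum_of I) {..<?N} I" "bij_betw (enum_of I') {..<?M} I'"
    using b[OF assms(1)] b[OF assms(2)] by (simp_all only: card)
  have ec: "bij_betw ?e {..<?N + ?M} (I \<union> I')" "bij_betw ?c {..<?N + ?M} (J \<union> J')"
    by (rule bij_betw_append_enum[OF e assms(5)])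
      (rule bij_betw_append_enum[OF b[OF assms(3)] b[OF assms(4)] assms(6)])
  have m: "enum_of I' a \<in> I'" if "a < ?M" for a
    using b[OF assms(2)] that card by (auto simp: bij_betw_def)
  have m': "enum_of J a \<in> J" if "a < ?N" for a
    using b[OF assms(3)] that by (auto simp: bij_betw_def)
  let ?A = "\<lambda>I J. Matrix.mat (card I) (card J) (\<lambda>(a, b). A (enum_of I a) (enum_of J b))"
  have "Matrix.mat (?N + ?M) (?N + ?M) (\<lambda>(a, b). A (?e a) (?c b))
      = four_block_mat (?A I J) (?A I J') (0\<^sub>m ?M ?N) (?A I' J')"
  proof (rule eq_matI, goal_cases)
    case (1 a b)
    then show ?case
      by (cases "a < ?N"; cases "b < ?N") (simp_all add: card zero m m')
  qed (simp_all add: card)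
  moreover have "Determinant.det \<dots> = Determinant.det (?A I J) * Determinant.det (?A I' J')"
    by (rule det_four_block_mat_lower_left_zero[of _ ?N _ ?M]) (auto simp: card)
  ultimately show ?thesis
    using idet_enum[OF ec, of A] by (auto simp: idet_def intro: sgn_eq_sym)
qed

lemma idet_block_diag:
  fixes A :: "'s \<times> 'i \<Rightarrow> 's \<times> 'j \<Rightarrow> 'f::idom"
  assumes "finite S" "finite I" "finite J" "card I = card J"
    and "\<And>s s' i j. s \<in> S \<Longrightarrow> s' \<in> S \<Longrightarrow> s \<noteq> s' \<Longrightarrow> i \<in> I \<Longrightarrow> j \<in> J \<Longrightarrow> A (s, i) (s', j) = 0"
  shows "idet (S \<times> I) (S \<times> J) A \<simeq> (\<Prod>s\<in>S. idet I J (\<lambda>i j. A (s, i) (s, j)))"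
  using assms(1,5)
proof (induction S rule: finite_induct)
  case empty
  then show ?case by (simp add: idet_empty)
next
  case (insert s S)
  have U: "insert s S \<times> X = {s} \<times> X \<union> S \<times> X" for X :: "'x set"
    by auto
  have "idet (insert s S \<times> I) (insert s S \<times> J) A
      \<simeq> idet ({s} \<times> I) ({s} \<times> J) A * idet (S \<times> I) (S \<times> J) A"
    unfolding U[of I] U[of J]
    by (rule idet_block) (use insert assms(2-4) in \<open>auto simp: card_cartesian_product\<close>)
  also have "\<dots> \<simeq> idet I J (\<lambda>i j. A (s, i) (s, j)) * (\<Prod>s\<in>S. idet I J (\<lambda>i j. A (s, i) (s, j)))"
  proof (rule sgn_eq_mult)
    show "idet ({s} \<times> I) ({s} \<times> J) A \<simeq> idet I J (\<lambda>i j. A (s, i) (s, j))"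
      by (rule idet_reindex[where f = "Pair s" and g = "Pair s"])
        (use assms in \<open>auto simp: bij_betw_def inj_on_def\<close>)
    show "idet (S \<times> I) (S \<times> J) A \<simeq> (\<Prod>s\<in>S. idet I J (\<lambda>i j. A (s, i) (s, j)))"
      by (rule insert.IH) (use insert.prems in auto)
  qed
  finally show ?case using insert by simp
qed

lemma sgn_eq_cancel:
  fixes a :: "'f::idom"
  assumes "a \<noteq> 0" "a * x \<simeq> a * y"
  shows "x \<simeq> y"
  using assms by (auto simp: sgn_eq_def simp flip: mult_minus_right)

lemma idet_uminus:
  fixes A :: "'i \<Rightarrow> 'j \<Rightarrow> 'f::comm_ring_1"
  assumes "card I = card J"
  shows "idet I J (\<lambda>i j. - A i j) \<simeq> idet I J A"
proof -
  let ?N = "card J"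
  let ?M = "\<lambda>A. Matrix.mat ?N ?N (\<lambda>(a, b). A (enum_of I a) (enum_of J b)) :: 'f mat"
  have "?M (\<lambda>i j. - A i j) = (- 1) \<cdot>\<^sub>m ?M A"
    by (rule eq_matI) simp_all
  then have "Determinant.det (?M (\<lambda>i j. - A i j)) = (- 1) ^ ?N * Determinant.det (?M A)"
    by simp
  then show ?thesis
    by (cases "even ?N") (simp_all add: idet_def assms sgn_eq_def)
qed

text \<open>The matrix is the tensor product of an identity with \<open>C\<close>, that is, the
  change of basis \<open>C\<close> performed in all blocks of an Alexander matrix at once.\<close>

lemma idet_kronecker_id:
  fixes C :: "'i \<Rightarrow> 'j \<Rightarrow> 'f::idom"
  assumes "finite S" "finite X" "finite Y" "card X = card Y"
  shows "idet (S \<times> X) (S \<times> Y) (\<lambda>(p, x) (q, y). if p = q then C x y else 0) \<simeq> idet X Y C ^ card S"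
proof -
  have "idet (S \<times> X) (S \<times> Y) (\<lambda>(p, x) (q, y). if p = q then C x y else 0)
      \<simeq> (\<Prod>s\<in>S. idet X Y (\<lambda>x y. (\<lambda>(p, x) (q, y). if p = q then C x y else 0) (s, x) (s, y)))"
    by (rule idet_block_diag[OF assms]) simp
  then show ?thesis by simp
qed

lemma sum_Times: "finite A \<Longrightarrow> finite B \<Longrightarrow> (\<Sum>z\<in>A \<times> B. h z) = (\<Sum>x\<in>A. \<Sum>y\<in>B. h (x, y))"
  by (simp add: sum.cartesian_product)

section \<open>Extending functions on a group to its group ring\<close>

text \<open>Linear extension, entry by entry, of a matrix-valued function of group elements.
  Multiplicativity of \<open>P\<close> first enters with \<open>group_matrix_rep\<close>.\<close>

definition group_ring_ext :: "('g \<Rightarrow> 'i \<Rightarrow> 'j \<Rightarrow> 'f::comm_ring_1) \<Rightarrow> ('g \<Rightarrow>\<^sub>0 int) \<Rightarrow> 'i \<Rightarrow> 'j \<Rightarrow> 'f" where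
  "group_ring_ext P a x y =
     (\<Sum>g \<in> Poly_Mapping.keys a. of_int (Poly_Mapping.lookup a g) * P g x y)"

text \<open>Coefficients may cancel in a sum, so \<open>a\<close>, \<open>b\<close> and
  \<open>a + b\<close> have different supports; over a common finite superset additivity becomes
  termwise.\<close>

lemma group_ring_ext_superset:
  assumes "finite S" "Poly_Mapping.keys a \<subseteq> S"
  shows "group_ring_ext P a x y = (\<Sum>g\<in>S. of_int (Poly_Mapping.lookup a g) * P g x y)"
  unfolding group_ring_ext_def using assms
  by (intro sum.mono_neutral_left) (auto simp: in_keys_iff)

lemma group_ring_ext_0 [simp]: "group_ring_ext P 0 x y = 0"
  by (simp add: group_ring_ext_def)

lemma group_ring_ext_of [simp]: "group_ring_ext P (frag_of g) x y = P g x y"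
  by (simp add: group_ring_ext_def)

lemma group_ring_ext_add:
  "group_ring_ext P (a + b) x y = group_ring_ext P a x y + group_ring_ext P b x y"
proof -
  let ?S = "Poly_Mapping.keys a \<union> Poly_Mapping.keys b"
  have "group_ring_ext P (a + b) x y = (\<Sum>g\<in>?S. of_int (Poly_Mapping.lookup (a + b) g) * P g x y)"
    by (rule group_ring_ext_superset) (auto simp: Poly_Mapping.keys_add)
  also have "\<dots> = group_ring_ext P a x y + group_ring_ext P b x y"
    by (subst (1 2) group_ring_ext_superset[of ?S])
      (auto simp: Poly_Mapping.lookup_add sum.distrib algebra_simps)
  finally show ?thesis .
qed

lemma group_ring_ext_minus: "group_ring_ext P (- a) x y = - group_ring_ext P a x y"
  by (simp add: group_ring_ext_def sum_negf)

lemma group_ring_ext_diff: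
  "group_ring_ext P (a - b) x y = group_ring_ext P a x y - group_ring_ext P b x y"
  using group_ring_ext_add[of P a "- b" x y] by (simp add: group_ring_ext_minus)

lemma group_ring_ext_hom:
  assumes "comm_ring_hom h"
  shows "h (group_ring_ext P a x y) = group_ring_ext (\<lambda>g x y. h (P g x y)) a x y"
proof -
  interpret comm_ring_hom h by fact
  show ?thesis by (simp add: group_ring_ext_def hom_distribs)
qed

lemma group_ring_ext_intertwine:
  assumes "Poly_Mapping.keys a \<subseteq> S"
    and "\<And>g. g \<in> S \<Longrightarrow> (\<Sum>y\<in>Y. C x y * P g y w) = (\<Sum>z\<in>X. P' g x z * C z w)"
  shows "(\<Sum>y\<in>Y. C x y * group_ring_ext P a y w) = (\<Sum>z\<in>X. group_ring_ext P' a x z * C z w)"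
proof -
  have "(\<Sum>y\<in>Y. C x y * group_ring_ext P a y w)
      = (\<Sum>g\<in>Poly_Mapping.keys a. of_int (Poly_Mapping.lookup a g) * (\<Sum>y\<in>Y. C x y * P g y w))"
    by (simp add: group_ring_ext_def sum_distrib_left mult_ac sum.swap[of _ Y])
  also have "\<dots> = (\<Sum>g\<in>Poly_Mapping.keys a. of_int (Poly_Mapping.lookup a g) * (\<Sum>z\<in>X. P' g x z * C z w))"
    using assms by (intro sum.cong) auto
  also have "\<dots> = (\<Sum>z\<in>X. group_ring_ext P' a x z * C z w)"
    by (simp add: group_ring_ext_def sum_distrib_left sum_distrib_right mult_ac sum.swap[of _ X])
  finally show ?thesis .
qed

section \<open>Wada's invariant\<close>

text \<open>\<open>D p q\<close> is to be the image of \<open>\<partial>r\<^sub>p / \<partial>s\<^sub>q\<close> in the group ring.\<close>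

definition wada_num :: "'i set \<Rightarrow> ('g \<Rightarrow> 'i \<Rightarrow> 'i \<Rightarrow> 'f::comm_ring_1) \<Rightarrow> nat \<Rightarrow> (nat \<Rightarrow> nat \<Rightarrow> 'g \<Rightarrow>\<^sub>0 int) \<Rightarrow> nat \<Rightarrow> 'f" where
  "wada_num J P m D j =
     idet ({..<m - 1} \<times> J) (({..<m} - {j}) \<times> J) (\<lambda>(p, x) (q, y). group_ring_ext P (D p q) x y)"

definition wada_den :: "'i set \<Rightarrow> ('g \<Rightarrow> 'i \<Rightarrow> 'i \<Rightarrow> 'f::comm_ring_1) \<Rightarrow> 'g \<Rightarrow> 'f" where
  "wada_den J P g = idet J J (\<lambda>x y. P g x y - (if x = y then 1 else 0))"

definition wada :: "'i set \<Rightarrow> ('g \<Rightarrow> 'i \<Rightarrow> 'i \<Rightarrow> 'f::field) \<Rightarrow> nat \<Rightarrow> (nat \<Rightarrow> nat \<Rightarrow> 'g \<Rightarrow>\<^sub>0 int) \<Rightarrow> (nat \<Rightarrow> 'g) \<Rightarrow> nat \<Rightarrow> 'f" where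
  "wada J P m D s j = wada_num J P m D j / wada_den J P (s j)"

text \<open>If C P = P' C, then (1 x C) M = M' (1 x C) for the Alexander matrices M and M', where 1
  x C is a tensor product over the relators on the left and over the remaining generators on the
  right. There are m - 1 of each, so both factors have determinant (det C)^(m-1) up to sign and
  cancel.\<close>

lemma wada_num_intertwine:
  fixes C :: "'i \<Rightarrow> 'k \<Rightarrow> 'f::idom"
  assumes fin: "finite X" "finite Y" and card: "card X = card Y" and C: "idet X Y C \<noteq> 0"
    and j: "j < m"
    and keys: "\<And>p q. p < m - 1 \<Longrightarrow> q < m \<Longrightarrow> Poly_Mapping.keys (D p q) \<subseteq> S"
    and tw: "\<And>g x w. g \<in> S \<Longrightarrow> x \<in> X \<Longrightarrow> w \<in> Y \<Longrightarrow>
      (\<Sum>y\<in>Y. C x y * P g y w) = (\<Sum>z\<in>X. P' g x z * C z w)"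
  shows "wada_num Y P m D j \<simeq> wada_num X P' m D j"
proof -
  let ?R = "{..<m - 1}" and ?Q = "{..<m} - {j}"
  let ?CC = "\<lambda>(p :: nat, x) (q, y). if p = q then C x y else 0"
  let ?M = "\<lambda>P (p, x) (q, y). group_ring_ext P (D p q) x y"
  have cardRQ: "card ?R = card ?Q" using j by simp
  have "idet (?R \<times> X) (?R \<times> Y) ?CC * idet (?R \<times> Y) (?Q \<times> Y) (?M P)
      = idet (?R \<times> X) (?Q \<times> Y) (\<lambda>i l. \<Sum>k\<in>?R \<times> Y. ?CC i k * ?M P k l)"
    using fin card cardRQ by (intro idet_mult) (simp_all add: card_cartesian_product)
  also have "\<dots> = idet (?R \<times> X) (?Q \<times> Y) (\<lambda>i l. \<Sum>k\<in>?Q \<times> X. ?M P' i k * ?CC k l)"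
  proof (rule idet_cong)
    fix i l assume i: "i \<in> ?R \<times> X" and l: "l \<in> ?Q \<times> Y"
    obtain p x where i': "i = (p, x)" "p \<in> ?R" "x \<in> X" using i by auto
    obtain q w where l': "l = (q, w)" "q \<in> ?Q" "w \<in> Y" using l by auto
    have "(\<Sum>k\<in>?R \<times> Y. ?CC i k * ?M P k l)
        = (\<Sum>r\<in>?R. \<Sum>y\<in>Y. if p = r then C x y * group_ring_ext P (D r q) y w else 0)"
      using fin by (subst sum_Times) (auto simp: i' l' intro!: sum.cong)
    also have "\<dots> = (\<Sum>r\<in>?R. if p = r then \<Sum>y\<in>Y. C x y * group_ring_ext P (D r q) y w else 0)"
      by (intro sum.cong) auto
    also have "\<dots> = (\<Sum>y\<in>Y. C x y * group_ring_ext P (D p q) y w)"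
      using i' by (simp add: sum.delta)
    also have "\<dots> = (\<Sum>z\<in>X. group_ring_ext P' (D p q) x z * C z w)"
      using i' l' keys[of p q] tw by (intro group_ring_ext_intertwine[of _ S]) auto
    also have "\<dots> = (\<Sum>r\<in>?Q. if r = q then \<Sum>z\<in>X. group_ring_ext P' (D p r) x z * C z w else 0)"
      using l' by (simp add: sum.delta)
    also have "\<dots> = (\<Sum>r\<in>?Q. \<Sum>z\<in>X. if r = q then group_ring_ext P' (D p r) x z * C z w else 0)"
      by (intro sum.cong) auto
    also have "\<dots> = (\<Sum>k\<in>?Q \<times> X. ?M P' i k * ?CC k l)"
      using fin by (subst sum_Times) (auto simp: i' l' intro!: sum.cong)
    finally show "(\<Sum>k\<in>?R \<times> Y. ?CC i k * ?M P k l) = (\<Sum>k\<in>?Q \<times> X. ?M P' i k * ?CC k l)" .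
  qed (use fin in auto)
  also have "\<dots> = idet (?R \<times> X) (?Q \<times> X) (?M P') * idet (?Q \<times> X) (?Q \<times> Y) ?CC"
    using fin card cardRQ by (intro idet_mult[symmetric]) (simp_all add: card_cartesian_product)
  finally have eq: "idet (?R \<times> X) (?R \<times> Y) ?CC * wada_num Y P m D j
      = wada_num X P' m D j * idet (?Q \<times> X) (?Q \<times> Y) ?CC"
    by (simp only: wada_num_def)
  let ?d = "idet X Y C ^ card ?R"
  have R: "idet (?R \<times> X) (?R \<times> Y) ?CC \<simeq> ?d"
    by (rule idet_kronecker_id) (use fin card in auto)
  have Q: "idet (?Q \<times> X) (?Q \<times> Y) ?CC \<simeq> ?d"
    unfolding cardRQ by (rule idet_kronecker_id) (use fin card in auto)
  have "?d * wada_num Y P m D j \<simeq> idet (?R \<times> X) (?R \<times> Y) ?CC * wada_num Y P m D j"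
    by (intro sgn_eq_mult sgn_eq_refl sgn_eq_sym[OF R])
  also have "\<dots> \<simeq> ?d * wada_num X P' m D j"
    unfolding eq by (subst mult.commute) (intro sgn_eq_mult sgn_eq_refl Q)
  finally show ?thesis
    by (rule sgn_eq_cancel[rotated]) (use C in simp)
qed

text \<open>From C (P(g) - 1) = (P'(g) - 1) C. The very same determinant of \<open>C\<close> stands
  on both sides, so the equality is exact.\<close>

lemma wada_den_intertwine:
  fixes C :: "'i \<Rightarrow> 'k \<Rightarrow> 'f::idom"
  assumes fin: "finite X" "finite Y" and card: "card X = card Y" and C: "idet X Y C \<noteq> 0"
    and tw: "\<And>x w. x \<in> X \<Longrightarrow> w \<in> Y \<Longrightarrow>
      (\<Sum>y\<in>Y. C x y * P g y w) = (\<Sum>z\<in>X. P' g x z * C z w)"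
  shows "wada_den Y P g = wada_den X P' g"
proof -
  let ?M = "\<lambda>P x y. P g x y - (if x = y then 1 else 0)"
  have "idet X Y C * idet Y Y (?M P) = idet X Y (\<lambda>x w. \<Sum>y\<in>Y. C x y * ?M P y w)"
    using fin card by (intro idet_mult) auto
  also have "\<dots> = idet X Y (\<lambda>x w. \<Sum>z\<in>X. ?M P' x z * C z w)"
  proof (rule idet_cong)
    fix x w assume "x \<in> X" "w \<in> Y"
    then show "(\<Sum>y\<in>Y. C x y * ?M P y w) = (\<Sum>z\<in>X. ?M P' x z * C z w)"
      using tw[of x w] fin
      by (simp add: algebra_simps sum_subtractf if_distrib[of "\<lambda>c. _ * c"] sum.delta sum.delta' cong: if_cong)
  qed (use fin in auto)
  also have "\<dots> = idet X X (?M P') * idet X Y C"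
    using fin card by (intro idet_mult[symmetric]) auto
  finally show ?thesis
    using C by (simp add: wada_den_def mult.commute)
qed

text \<open>In each block of the Alexander matrix the summand index is the inner one. Moving it to
  the front by \<open>?f\<close> makes the whole matrix block diagonal, with one Alexander matrix
  for each summand.\<close>

lemma wada_num_direct_sum:
  fixes Q :: "'s \<Rightarrow> 'g \<Rightarrow> 'i \<Rightarrow> 'i \<Rightarrow> 'f::idom"
  assumes fin: "finite S" "finite X" and j: "j < m"
  shows "wada_num (S \<times> X) (\<lambda>g (i, x) (i', y). if i = i' then Q i g x y else 0) m D j
       \<simeq> (\<Prod>i\<in>S. wada_num X (Q i) m D j)"
proof -
  let ?P = "\<lambda>g (i, x) (i', y). if i = i' then Q i g x y else 0"
  let ?R = "{..<m - 1}" and ?C = "{..<m} - {j}"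
  let ?f = "\<lambda>(i, p, x). (p, i, x)"
  let ?M = "\<lambda>(p, x) (q, y). group_ring_ext ?P (D p q) x y"
  have card: "card ?R = card ?C" using j by simp
  have "bij_betw ?f (S \<times> T \<times> X) (T \<times> S \<times> X)" for T :: "nat set"
    by (rule bij_betw_byWitness[where f' = "\<lambda>(p, i, x). (i, p, x)"]) auto
  then have "wada_num (S \<times> X) ?P m D j
      \<simeq> idet (S \<times> ?R \<times> X) (S \<times> ?C \<times> X) (\<lambda>a b. ?M (?f a) (?f b))"
    unfolding wada_num_def using fin card
    by (intro idet_reindex) (auto simp: card_cartesian_product simp del: card_Diff_insert)
  also have "\<dots> \<simeq> (\<Prod>i\<in>S. idet (?R \<times> X) (?C \<times> X) (\<lambda>a b. ?M (?f (i, a)) (?f (i, b))))"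
    by (rule idet_block_diag) (use fin card in \<open>auto simp: card_cartesian_product group_ring_ext_def\<close>)
  also have "(\<Prod>i\<in>S. idet (?R \<times> X) (?C \<times> X) (\<lambda>a b. ?M (?f (i, a)) (?f (i, b))))
      = (\<Prod>i\<in>S. wada_num X (Q i) m D j)"
    unfolding wada_num_def
    by (intro prod.cong refl idet_cong) (use fin in \<open>auto simp: group_ring_ext_def\<close>)
  finally show ?thesis .
qed

lemma wada_den_direct_sum:
  fixes Q :: "'s \<Rightarrow> 'g \<Rightarrow> 'i \<Rightarrow> 'i \<Rightarrow> 'f::idom"
  assumes fin: "finite S" "finite X"
  shows "wada_den (S \<times> X) (\<lambda>g (i, x) (i', y). if i = i' then Q i g x y else 0) g
       \<simeq> (\<Prod>i\<in>S. wada_den X (Q i) g)"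
proof -
  let ?M = "\<lambda>a b. (case a of (i, x) \<Rightarrow> \<lambda>(i', y). if i = i' then Q i g x y else 0) b
    - (if a = b then 1 else 0)"
  have "idet (S \<times> X) (S \<times> X) ?M \<simeq> (\<Prod>i\<in>S. idet X X (\<lambda>x y. ?M (i, x) (i, y)))"
    by (rule idet_block_diag) (use fin in auto)
  then show ?thesis
    by (simp add: wada_den_def)
qed

lemma wada_direct_sum:
  fixes Q :: "'s \<Rightarrow> 'g \<Rightarrow> 'i \<Rightarrow> 'i \<Rightarrow> 'f::field"
  assumes "finite S" "finite X" "j < m"
  shows "wada (S \<times> X) (\<lambda>g (i, x) (i', y). if i = i' then Q i g x y else 0) m D s j
       \<simeq> (\<Prod>i\<in>S. wada X (Q i) m D s j)"
  unfolding wada_def prod_dividef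
  by (intro sgn_eq_divide wada_num_direct_sum wada_den_direct_sum assms)

lemma wada_num_hom:
  assumes "comm_ring_hom h" "finite J"
  shows "h (wada_num J P m D j) = wada_num J (\<lambda>g x y. h (P g x y)) m D j"
  unfolding wada_num_def idet_hom[OF assms(1)]
  by (rule idet_cong) (use assms in \<open>auto simp: group_ring_ext_hom\<close>)

lemma wada_den_hom:
  assumes "comm_ring_hom h" "finite J"
  shows "h (wada_den J P g) = wada_den J (\<lambda>g x y. h (P g x y)) g"
proof -
  interpret comm_ring_hom h by fact
  show ?thesis
    unfolding wada_den_def idet_hom[OF assms(1)]
    by (rule idet_cong) (use assms in \<open>auto simp: hom_distribs\<close>)
qed

text \<open>Let \<open>M\<^sub>j\<close> be \<open>M\<close> without its \<open>j\<close>-th block column. Multiplying block column \<open>j'\<close> of \<open>M\<^sub>j\<close> by \<open>X\<^sub>j\<^sub>'\<close>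
  and adding the other block columns multiplied by their \<open>X\<^sub>i\<close> turns it into block column \<open>j\<close> multiplied
  by \<open>-X\<^sub>j\<close>. This is \<open>M\<^sub>j U = M\<^sub>j\<^sub>' V\<close> with block triangular \<open>U\<close> and \<open>V\<close>.\<close>

lemma exchange_block_column:
  fixes M :: "nat \<Rightarrow> nat \<Rightarrow> 'i \<Rightarrow> 'i \<Rightarrow> 'f::idom"
  assumes fin: "finite J" and j: "j < m" "j' < m" "j \<noteq> j'"
    and rel: "\<And>p x y. p < m - 1 \<Longrightarrow> x \<in> J \<Longrightarrow> y \<in> J \<Longrightarrow> (\<Sum>q<m. \<Sum>z\<in>J. M p q x z * X q z y) = 0"
  shows "idet ({..<m - 1} \<times> J) (({..<m} - {j}) \<times> J) (\<lambda>(p, x) (q, y). M p q x y) * idet J J (X j')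
       \<simeq> idet ({..<m - 1} \<times> J) (({..<m} - {j'}) \<times> J) (\<lambda>(p, x) (q, y). M p q x y) * idet J J (X j)"
proof -
  let ?R = "{..<m - 1}" and ?Q = "{..<m} - {j}" and ?Q' = "{..<m} - {j'}"
  let ?O = "{..<m} - {j, j'}"
  let ?M = "\<lambda>(p, x) (q, y). M p q x y"
  \<comment> \<open>\<open>?U\<close> is the identity except in block column \<open>j'\<close>,
    which holds all the X_i. \<open>?V\<close> matches the common indices and sends the extra row
    block \<open>j\<close> to column block \<open>j'\<close> through -X_j.\<close>
  let ?U = "\<lambda>(i, x) (q, y). if q = j' then X i x y else if i = q \<and> x = y then 1 else 0"
  let ?V = "\<lambda>(i, x) (q, y). if q = j' then (if i = j then - X j x y else 0)
                             else if i = q \<and> x = y then 1 else 0"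
  \<comment> \<open>The common value of both products.\<close>
  let ?N = "\<lambda>(p, x) (q, y). if q = j' then - (\<Sum>z\<in>J. M p j x z * X j z y) else M p q x y"
  have card: "card ?R = card ?Q" "card ?R = card ?Q'" using j by simp_all
  have Q: "?Q \<times> J = ?O \<times> J \<union> {j'} \<times> J" and Q': "?Q' \<times> J = ?O \<times> J \<union> {j} \<times> J"
    using j by auto
  have id: "idet (?O \<times> J) (?O \<times> J) W = 1"
    if "\<And>i x q y. i \<in> ?O \<Longrightarrow> q \<in> ?O \<Longrightarrow> W (i, x) (q, y) = (if i = q \<and> x = y then 1 else 0)"
    for W :: "nat \<times> 'i \<Rightarrow> nat \<times> 'i \<Rightarrow> 'f"
  proof -
    have "idet (?O \<times> J) (?O \<times> J) W = idet (?O \<times> J) (?O \<times> J) (\<lambda>a b. if a = b then 1 else 0)"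
      by (rule idet_cong) (use fin that in \<open>auto split: if_splits\<close>)
    then show ?thesis using idet_id[of "?O \<times> J"] fin by simp
  qed
  have U: "idet (?Q \<times> J) (?Q \<times> J) ?U \<simeq> idet J J (X j')"
  proof -
    have "idet (?Q \<times> J) (?Q \<times> J) ?U \<simeq> idet (?O \<times> J) (?O \<times> J) ?U * idet ({j'} \<times> J) ({j'} \<times> J) ?U"
      unfolding Q by (rule idet_block) (use fin in \<open>auto split: if_splits\<close>)
    also have "idet (?O \<times> J) (?O \<times> J) ?U = 1"
      by (rule id) auto
    also have "1 * idet ({j'} \<times> J) ({j'} \<times> J) ?U \<simeq> 1 * idet J J (\<lambda>x y. ?U (j', x) (j', y))"
      by (intro sgn_eq_mult sgn_eq_refl idet_reindex[where f = "Pair j'" and g = "Pair j'"])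
        (use fin in \<open>auto simp: bij_betw_def inj_on_def\<close>)
    finally show ?thesis by simp
  qed
  have V: "idet (?Q' \<times> J) (?Q \<times> J) ?V \<simeq> idet J J (X j)"
  proof -
    have "idet (?Q' \<times> J) (?Q \<times> J) ?V \<simeq> idet (?O \<times> J) (?O \<times> J) ?V * idet ({j} \<times> J) ({j'} \<times> J) ?V"
      unfolding Q Q' by (rule idet_block) (use fin in \<open>auto simp: card_cartesian_product split: if_splits\<close>)
    also have "idet (?O \<times> J) (?O \<times> J) ?V = 1"
      by (rule id) auto
    also have "1 * idet ({j} \<times> J) ({j'} \<times> J) ?V \<simeq> 1 * idet J J (\<lambda>x y. ?V (j, x) (j', y))"
      by (intro sgn_eq_mult sgn_eq_refl idet_reindex[where f = "Pair j" and g = "Pair j'"])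
        (use fin in \<open>auto simp: bij_betw_def inj_on_def\<close>)
    also have "1 * idet J J (\<lambda>x y. ?V (j, x) (j', y)) \<simeq> idet J J (X j)"
      using idet_uminus[of J J "X j"] by simp
    finally show ?thesis .
  qed
  have MU: "(\<Sum>k\<in>?Q \<times> J. ?M (p, x) k * ?U k (q, y)) = ?N (p, x) (q, y)"
    if "p < m - 1" "x \<in> J" "q \<in> ?Q" "y \<in> J" for p x q y
  proof (cases "q = j'")
    case True
    \<comment> \<open>Block column \<open>j'\<close> of the product collects all terms of the
      relation \<open>rel\<close> except the one for \<open>j\<close>.\<close>
    have "(\<Sum>q<m. \<Sum>z\<in>J. M p q x z * X q z y)
        = (\<Sum>z\<in>J. M p j x z * X j z y) + (\<Sum>i\<in>?Q. \<Sum>z\<in>J. M p i x z * X i z y)"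
      using j by (intro sum.remove) auto
    then show ?thesis
      using True rel[of p x y] that fin by (simp add: sum_Times eq_neg_iff_add_eq_0 add.commute)
  next
    case False
    have "(\<Sum>k\<in>?Q \<times> J. ?M (p, x) k * ?U k (q, y)) = (\<Sum>k\<in>?Q \<times> J. if k = (q, y) then M p q x y else 0)"
      using False by (intro sum.cong) (auto split: if_splits)
    then show ?thesis
      using False that fin by (simp add: sum.delta)
  qed
  have MV: "(\<Sum>k\<in>?Q' \<times> J. ?M (p, x) k * ?V k (q, y)) = ?N (p, x) (q, y)"
    if "p < m - 1" "x \<in> J" "q \<in> ?Q" "y \<in> J" for p x q y
  proof (cases "q = j'")
    case True
    have "(\<Sum>k\<in>?Q' \<times> J. ?M (p, x) k * ?V k (q, y))
        = (\<Sum>i\<in>?Q'. \<Sum>z\<in>J. ?M (p, x) (i, z) * ?V (i, z) (q, y))"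
      using fin by (intro sum_Times) auto
    also have "\<dots> = (\<Sum>i\<in>?Q'. if i = j then \<Sum>z\<in>J. M p j x z * - X j z y else 0)"
      using True by (intro sum.cong) auto
    finally show ?thesis
      using True j by (simp add: sum.delta sum_negf)
  next
    case False
    have "(\<Sum>k\<in>?Q' \<times> J. ?M (p, x) k * ?V k (q, y)) = (\<Sum>k\<in>?Q' \<times> J. if k = (q, y) then M p q x y else 0)"
      using False by (intro sum.cong) (auto split: if_splits)
    then show ?thesis
      using False that fin by (simp add: sum.delta)
  qed
  have "idet (?R \<times> J) (?Q \<times> J) ?M * idet (?Q \<times> J) (?Q \<times> J) ?U
      = idet (?R \<times> J) (?Q \<times> J) (\<lambda>i l. \<Sum>k\<in>?Q \<times> J. ?M i k * ?U k l)"
    using fin card by (intro idet_mult) (simp_all add: card_cartesian_product)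
  also have "\<dots> = idet (?R \<times> J) (?Q \<times> J) (\<lambda>i l. \<Sum>k\<in>?Q' \<times> J. ?M i k * ?V k l)"
  proof (rule idet_cong)
    fix a b assume "a \<in> ?R \<times> J" "b \<in> ?Q \<times> J"
    then show "(\<Sum>k\<in>?Q \<times> J. ?M a k * ?U k b) = (\<Sum>k\<in>?Q' \<times> J. ?M a k * ?V k b)"
      using MU MV by (cases a; cases b) (simp only: mem_Sigma_iff lessThan_iff)
  qed (use fin in auto)
  also have "\<dots> = idet (?R \<times> J) (?Q' \<times> J) ?M * idet (?Q' \<times> J) (?Q \<times> J) ?V"
    using fin card by (intro idet_mult[symmetric]) (simp_all add: card_cartesian_product)
  finally have eq: "idet (?R \<times> J) (?Q \<times> J) ?M * idet (?Q \<times> J) (?Q \<times> J) ?U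
      = idet (?R \<times> J) (?Q' \<times> J) ?M * idet (?Q' \<times> J) (?Q \<times> J) ?V" .
  have "idet (?R \<times> J) (?Q \<times> J) ?M * idet J J (X j')
      \<simeq> idet (?R \<times> J) (?Q \<times> J) ?M * idet (?Q \<times> J) (?Q \<times> J) ?U"
    by (rule sgn_eq_mult[OF sgn_eq_refl sgn_eq_sym[OF U]])
  also have "\<dots> \<simeq> idet (?R \<times> J) (?Q' \<times> J) ?M * idet J J (X j)"
    unfolding eq by (rule sgn_eq_mult[OF sgn_eq_refl V])
  finally show ?thesis .
qed

section \<open>Fox calculus\<close>

lemma (in group) word_value_Nil [simp]: "word_value G s [] = \<one>"
  by (simp add: word_value_def)

lemma (in group) word_value_Cons:
  "word_value G s (l # w) = (if snd l then s (fst l) else inv (s (fst l))) \<otimes> word_value G s w"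
  by (simp add: word_value_def)

lemma (in group) letter_closed:
  assumes "s ` {..<m} \<subseteq> carrier G" "fst l < m"
  shows "(if snd l then s (fst l) else inv (s (fst l))) \<in> carrier G"
  using assms by auto

lemma (in group) word_value_closed:
  assumes "s ` {..<m} \<subseteq> carrier G" "fst ` set w \<subseteq> {..<m}"
  shows "word_value G s w \<in> carrier G"
  using assms(2)
proof (induction w)
  case (Cons l w)
  then show ?case
    unfolding word_value_Cons by (intro m_closed letter_closed[OF assms(1)]) auto
qed simp

lemma (in group) word_value_push_letter:
  assumes s: "s ` {..<m} \<subseteq> carrier G" and "fst l < m" "fst ` set w \<subseteq> {..<m}"
  shows "word_value G s (push_letter l w) = word_value G s (l # w)"
proof (cases w)
  case (Cons y v)
  have v: "word_value G s v \<in> carrier G"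
    using assms Cons by (intro word_value_closed[OF s]) auto
  have l: "s (fst l) \<in> carrier G" using assms by auto
  show ?thesis
  proof (cases "y = inv_letter l")
    case True
    then show ?thesis
      using Cons v l by (auto simp: word_value_Cons inv_letter_def m_assoc[symmetric])
  qed (simp add: Cons)
qed simp

lemma (in group) word_value_free_reduce:
  assumes s: "s ` {..<m} \<subseteq> carrier G" and "fst ` set w \<subseteq> {..<m}"
  shows "word_value G s (free_reduce w) = word_value G s w"
  using assms(2)
proof (induction w)
  case (Cons l w)
  have "fst ` set (free_reduce w) \<subseteq> {..<m}"
    using set_free_reduce[of w] Cons.prems by auto
  then show ?case
    using Cons by (simp add: free_reduce_Cons word_value_push_letter[OF s] word_value_Cons)
qed simp

text \<open>The map of group rings that is inlined in \<open>wada_Phi\<close>. Naming it lets Fox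
  calculus be evaluated in the group before any representation is applied.\<close>

definition group_ring_value :: "('a, 'c) monoid_scheme \<Rightarrow> (nat \<Rightarrow> 'a) \<Rightarrow> (letter list \<Rightarrow>\<^sub>0 int) \<Rightarrow> 'a \<Rightarrow>\<^sub>0 int" where
  "group_ring_value G s = frag_extend (\<lambda>w. frag_of (word_value G s w))"

lemma keys_fox:
  assumes "fst ` set w \<subseteq> {..<m}"
  shows "Poly_Mapping.keys (fox q w) \<subseteq> {v. fst ` set v \<subseteq> {..<m}}"
  using assms
proof (induction w)
  case (Cons l w)
  have "Poly_Mapping.keys (fox_letter q l) \<subseteq> {v. fst ` set v \<subseteq> {..<m}}"
    using Cons.prems by (auto simp: fox_letter_def)
  moreover have "Poly_Mapping.keys (frag_extend (\<lambda>v. frag_of (free_reduce (l # v))) (fox q w))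
      \<subseteq> (\<Union>v\<in>Poly_Mapping.keys (fox q w). {free_reduce (l # v)})"
    using keys_frag_extend[of "\<lambda>v. frag_of (free_reduce (l # v))" "fox q w"] by simp
  moreover have "fst ` set (free_reduce (l # v)) \<subseteq> {..<m}" if "v \<in> Poly_Mapping.keys (fox q w)" for v
    using set_free_reduce[of "l # v"] Cons that by (force simp del: free_reduce_Cons)
  moreover have "Poly_Mapping.keys (fox q (l # w)) \<subseteq> Poly_Mapping.keys (fox_letter q l)
      \<union> Poly_Mapping.keys (frag_extend (\<lambda>v. frag_of (free_reduce (l # v))) (fox q w))"
    by (simp add: Poly_Mapping.keys_add)
  ultimately show ?case by blast
qed simp

text \<open>Intertwining relations between representations hold only on the carrier, so the supports
  of all entries of the Alexander matrix have to be kept there.\<close>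

lemma (in group) keys_group_ring_value_fox:
  assumes "s ` {..<m} \<subseteq> carrier G" "fst ` set w \<subseteq> {..<m}"
  shows "Poly_Mapping.keys (group_ring_value G s (fox q w)) \<subseteq> carrier G"
proof -
  have "Poly_Mapping.keys (group_ring_value G s (fox q w))
      \<subseteq> (\<Union>v\<in>Poly_Mapping.keys (fox q w). {word_value G s v})"
    using keys_frag_extend[of "\<lambda>w. frag_of (word_value G s w)" "fox q w"]
    by (simp add: group_ring_value_def)
  moreover have "word_value G s v \<in> carrier G" if "v \<in> Poly_Mapping.keys (fox q w)" for v
    using keys_fox[OF assms(2), of q] that by (intro word_value_closed[OF assms(1)]) auto
  ultimately show ?thesis by blast
qed

text \<open>Matrices indexed by \<open>J\<close> and constrained only on \<open>J\<close>. The order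
  of factors in \<open>rep_mult\<close> is the one for right multiplication acting on row
  vectors.\<close>

locale group_matrix_rep = group G for G :: "('g, 'c) monoid_scheme" (structure) +
  fixes J :: "'i set" and P :: "'g \<Rightarrow> 'i \<Rightarrow> 'i \<Rightarrow> 'f::idom"
  assumes finite_J: "finite J"
    and rep_one: "x \<in> J \<Longrightarrow> y \<in> J \<Longrightarrow> P \<one> x y = (if x = y then 1 else 0)"
    and rep_mult: "g \<in> carrier G \<Longrightarrow> h \<in> carrier G \<Longrightarrow> x \<in> J \<Longrightarrow> y \<in> J \<Longrightarrow>
      P (g \<otimes> h) x y = (\<Sum>z\<in>J. P g x z * P h z y)"
begin

text \<open>Multiplicativity on the group ring in the one case that the recursion of
  \<open>fox\<close> produces, a single letter times an arbitrary element. By linearity it reduces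
  to a single word.\<close>

lemma group_ring_ext_cons:
  assumes s: "s ` {..<m} \<subseteq> carrier G" and l: "fst l < m"
    and a: "Poly_Mapping.keys a \<subseteq> {v. fst ` set v \<subseteq> {..<m}}" and xy: "x \<in> J" "y \<in> J"
  shows "group_ring_ext P (group_ring_value G s (frag_extend (\<lambda>v. frag_of (free_reduce (l # v))) a)) x y
       = (\<Sum>z\<in>J. P (if snd l then s (fst l) else inv (s (fst l))) x z *
                 group_ring_ext P (group_ring_value G s a) z y)"
  using a
proof (induction a rule: frag_induction)
  case (one v)
  then have "word_value G s (free_reduce (l # v)) = word_value G s (l # v)"
    by (intro word_value_free_reduce[OF s]) (use l in auto)
  then show ?case
    using one xy letter_closed[OF s l] word_value_closed[OF s, of v]
    by (simp add: group_ring_value_def word_value_Cons rep_mult)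
next
  case (diff a b)
  then show ?case
    by (simp add: group_ring_value_def frag_extend_diff group_ring_ext_diff right_diff_distrib sum_subtractf)
qed (simp add: group_ring_value_def)

text \<open>Induction on the word: since d(lw) = dl + l dw, the sum for the letter l followed by w
  is (l - 1) + l (w - 1) = lw - 1. For the letter alone only the derivative with respect to its own
  generator contributes.\<close>

lemma fundamental_formula:
  assumes s: "s ` {..<m} \<subseteq> carrier G" and w: "fst ` set w \<subseteq> {..<m}" and xy: "x \<in> J" "y \<in> J"
  shows "(\<Sum>q<m. \<Sum>z\<in>J. group_ring_ext P (group_ring_value G s (fox q w)) x z *
             (P (s q) z y - (if z = y then 1 else 0)))
       = P (word_value G s w) x y - (if x = y then 1 else 0)"
  using w xy
proof (induction w arbitrary: x)
  case Nil
  then show ?case by (simp add: rep_one group_ring_value_def)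
next
  case (Cons l w)
  let ?E = "\<lambda>a. group_ring_ext P (group_ring_value G s a)"
  let ?X = "\<lambda>q z. P (s q) z y - (if z = y then 1 else 0)"
  let ?g = "if snd l then s (fst l) else inv (s (fst l))"
  have l: "fst l < m" and w: "fst ` set w \<subseteq> {..<m}" using Cons.prems by auto
  have g: "?g \<in> carrier G" by (rule letter_closed[OF s l])
  have sl: "s (fst l) \<in> carrier G" using s l by auto
  have "(\<Sum>q<m. \<Sum>z\<in>J. ?E (fox_letter q l) x z * ?X q z)
      = (\<Sum>q<m. if q = fst l then \<Sum>z\<in>J. ?E (fox_letter q l) x z * ?X q z else 0)"
    by (intro sum.cong) (auto simp: fox_letter_def group_ring_value_def)
  also have "\<dots> = (\<Sum>z\<in>J. ?E (fox_letter (fst l) l) x z * ?X (fst l) z)"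
    using l by (simp add: sum.delta)
  also have "\<dots> = P ?g x y - (if x = y then 1 else 0)"
  proof (cases "snd l")
    case True
    have "(\<Sum>z\<in>J. ?E (fox_letter (fst l) l) x z * ?X (fst l) z)
        = (\<Sum>z\<in>J. if z = x then ?X (fst l) z else 0)"
      using True Cons.prems by (intro sum.cong) (auto simp: fox_letter_def group_ring_value_def rep_one)
    then show ?thesis
      using True Cons.prems finite_J by (simp add: sum.delta)
  next
    case False
    \<comment> \<open>For an inverse letter the identity is -s^(-1) (s - 1) = s^(-1) - 1.\<close>
    have "(\<Sum>z\<in>J. ?E (fox_letter (fst l) l) x z * ?X (fst l) z)
        = (\<Sum>z\<in>J. (if z = y then P (inv (s (fst l))) x y else 0) - P (inv (s (fst l))) x z * P (s (fst l)) z y)"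
      using False sl
      by (intro sum.cong)
        (auto simp: fox_letter_def group_ring_value_def frag_extend_minus group_ring_ext_minus
          word_value_Cons algebra_simps)
    also have "\<dots> = P (inv (s (fst l))) x y - P (inv (s (fst l)) \<otimes> s (fst l)) x y"
      by (simp only: sum_subtractf sum.delta[OF finite_J]
          rep_mult[OF inv_closed[OF sl] sl Cons.prems(2,3)] Cons.prems(3) if_True)
    finally show ?thesis
      using False Cons.prems sl by (simp add: rep_one)
  qed
  finally have letter: "(\<Sum>q<m. \<Sum>z\<in>J. ?E (fox_letter q l) x z * ?X q z)
      = P ?g x y - (if x = y then 1 else 0)" .
  have "(\<Sum>q<m. \<Sum>z\<in>J. ?E (frag_extend (\<lambda>v. frag_of (free_reduce (l # v))) (fox q w)) x z * ?X q z)
      = (\<Sum>q<m. \<Sum>z\<in>J. (\<Sum>u\<in>J. P ?g x u * ?E (fox q w) u z) * ?X q z)"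
  proof (rule sum.cong[OF refl], rule sum.cong[OF refl])
    fix q z assume "z \<in> J"
    then show "?E (frag_extend (\<lambda>v. frag_of (free_reduce (l # v))) (fox q w)) x z * ?X q z
        = (\<Sum>u\<in>J. P ?g x u * ?E (fox q w) u z) * ?X q z"
      using group_ring_ext_cons[OF s l keys_fox[OF w] Cons.prems(2), of z q] by (simp only:)
  qed
  also have "\<dots> = (\<Sum>q<m. \<Sum>z\<in>J. \<Sum>u\<in>J. P ?g x u * (?E (fox q w) u z * ?X q z))"
    by (simp only: sum_distrib_right mult.assoc)
  also have "\<dots> = (\<Sum>q<m. \<Sum>u\<in>J. \<Sum>z\<in>J. P ?g x u * (?E (fox q w) u z * ?X q z))"
    by (rule sum.cong[OF refl], rule sum.swap)
  also have "\<dots> = (\<Sum>u\<in>J. \<Sum>q<m. \<Sum>z\<in>J. P ?g x u * (?E (fox q w) u z * ?X q z))"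
    by (rule sum.swap)
  also have "\<dots> = (\<Sum>u\<in>J. P ?g x u * (\<Sum>q<m. \<Sum>z\<in>J. ?E (fox q w) u z * ?X q z))"
    by (simp only: sum_distrib_left)
  also have "\<dots> = (\<Sum>u\<in>J. P ?g x u * (P (word_value G s w) u y - (if u = y then 1 else 0)))"
    using Cons.IH[OF w _ Cons.prems(3)] by (intro sum.cong) auto
  also have "\<dots> = (\<Sum>u\<in>J. P ?g x u * P (word_value G s w) u y - (if u = y then P ?g x y else 0))"
    by (intro sum.cong) (auto simp: algebra_simps)
  also have "\<dots> = P (?g \<otimes> word_value G s w) x y - P ?g x y"
    using Cons.prems finite_J
    by (simp only: sum_subtractf sum.delta rep_mult[OF g word_value_closed[OF s w]] if_True)
  finally show ?case
    using letter
    by (simp add: group_ring_value_def frag_extend_add group_ring_ext_add distrib_right sum.distrib word_value_Cons)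
qed

end

context group_matrix_rep
begin

text \<open>A relator has value 1, so by the fundamental formula the block columns of the Alexander
  matrix, multiplied by P(s_q) - 1, add up to zero. The cross-multiplied form stays valid when a
  denominator vanishes.\<close>

lemma wada_change_generator:
  fixes w :: "nat \<Rightarrow> letter list"
  assumes s: "s ` {..<m} \<subseteq> carrier G" and j: "j < m" "j' < m"
    and w: "\<And>p. p < m - 1 \<Longrightarrow> fst ` set (w p) \<subseteq> {..<m}"
    and rel: "\<And>p. p < m - 1 \<Longrightarrow> word_value G s (w p) = \<one>"
  shows "wada_num J P m (\<lambda>p q. group_ring_value G s (fox q (w p))) j * wada_den J P (s j')
       \<simeq> wada_num J P m (\<lambda>p q. group_ring_value G s (fox q (w p))) j' * wada_den J P (s j)"
proof (cases "j = j'")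
  case False
  let ?M = "\<lambda>p q. group_ring_ext P (group_ring_value G s (fox q (w p)))"
  let ?X = "\<lambda>q x y. P (s q) x y - (if x = y then 1 else 0)"
  have "(\<Sum>q<m. \<Sum>z\<in>J. ?M p q x z * ?X q z y) = 0" if "p < m - 1" "x \<in> J" "y \<in> J" for p x y
    using fundamental_formula[OF s w[OF that(1)] that(2,3)] rel[OF that(1)] rep_one[OF that(2,3)] by simp
  then show ?thesis
    unfolding wada_num_def wada_den_def by (rule exchange_block_column[OF finite_J j False])
qed simp

end

section \<open>From numbered block matrices to determinants over index sets\<close>

lemma bij_betw_div_mod:
  assumes "0 < d"
  shows "bij_betw (\<lambda>p. (p div d, p mod d)) {..<d * N} ({..<N} \<times> {..<d :: nat})"
proof (rule bij_betw_byWitness[where f' = "\<lambda>(a, b). a * d + b"])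
  show "(\<lambda>p. (p div d, p mod d)) ` {..<d * N} \<subseteq> {..<N} \<times> {..<d}"
    using assms by (auto simp: less_mult_imp_div_less mult.commute)
  have "a * d + b < d * N" if "a < N" "b < d" for a b
  proof -
    have "a * d + b < (a + 1) * d" using that by simp
    also have "\<dots> \<le> N * d" using that by (intro mult_right_mono) auto
    finally show ?thesis by (simp add: mult.commute)
  qed
  then show "(\<lambda>(a, b). a * d + b) ` ({..<N} \<times> {..<d}) \<subseteq> {..<d * N}"
    by auto
qed (use assms in auto)

lemma bij_betw_skip:
  assumes "j < (m::nat)"
  shows "bij_betw (\<lambda>a. if a < j then a else a + 1) {..<m - 1} ({..<m} - {j})"
  by (rule bij_betw_byWitness[where f' = "\<lambda>a. if a < j then a else a - 1"]) (use assms in auto)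

lemma bij_betw_Times:
  "bij_betw f A A' \<Longrightarrow> bij_betw g B B' \<Longrightarrow> bij_betw (\<lambda>(a, b). (f a, g b)) (A \<times> B) (A' \<times> B')"
  unfolding map_prod_def[symmetric] by (rule bij_betw_map_prod)

lemma (in group) twisted_alexander_eq_wada:
  fixes R :: "'a \<Rightarrow> 'i \<Rightarrow> 'i \<Rightarrow> 'r::idom" and \<phi> :: "'a \<Rightarrow> int"
  defines "P \<equiv> \<lambda>g x y. t_ratfun powi \<phi> g * const_ratfun (R g x y)"
  assumes d: "0 < d" and e: "bij_betw e {..<d} J" and j: "j < m" and s: "s j \<in> carrier G"
    and \<rho>: "\<And>g a b. a < d \<Longrightarrow> b < d \<Longrightarrow> \<rho> g $$ (a, b) = R g (e a) (e b)"
    and P1: "\<And>x y. x \<in> J \<Longrightarrow> y \<in> J \<Longrightarrow> P \<one> x y = (if x = y then 1 else 0)"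
  shows "twisted_alexander d G m s r \<phi> \<rho> j
       \<simeq> wada J P m (\<lambda>p q. group_ring_value G s (fox q (r p))) s j"
proof -
  have fin: "finite J" using bij_betw_finite[OF e] by simp
  have eJ: "e a \<in> J" if "a < d" for a using e that by (auto simp: bij_betw_def)
  have Phi: "wada_Phi d G s \<phi> \<rho> c $$ (a, b) = group_ring_ext P (group_ring_value G s c) (e a) (e b)"
    if "a < d" "b < d" for a b c
    using that by (simp add: wada_Phi_def group_ring_rep_def group_ring_ext_def group_ring_value_def P_def \<rho>)
  let ?h = "\<lambda>q. if q < j then q else q + 1"
  let ?M = "\<lambda>(p, x) (q, y). group_ring_ext P (group_ring_value G s (fox q (r p))) x y"
  let ?er = "(\<lambda>(a, b). (a, e b)) \<circ> (\<lambda>p. (p div d, p mod d))"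
  let ?ec = "(\<lambda>(a, b). (?h a, e b)) \<circ> (\<lambda>p. (p div d, p mod d))"
  have er: "bij_betw ?er {..<d * (m - 1)} ({..<m - 1} \<times> J)"
    using bij_betw_Times[OF bij_betw_id e, of "{..<m - 1}"]
    by (intro bij_betw_trans[OF bij_betw_div_mod[OF d]]) simp
  have ec: "bij_betw ?ec {..<d * (m - 1)} (({..<m} - {j}) \<times> J)"
    by (intro bij_betw_trans[OF bij_betw_div_mod[OF d]] bij_betw_Times[OF bij_betw_skip[OF j] e])
  have num: "delete_block_col d j (alexander_matrix d G m s r \<phi> \<rho>)
      = Matrix.mat (d * (m - 1)) (d * (m - 1)) (\<lambda>(a, b). ?M (?er a) (?ec b))"
  proof (rule eq_matI)
    fix a b assume ab: "a < dim_row (Matrix.mat (d * (m - 1)) (d * (m - 1)) (\<lambda>(a, b). ?M (?er a) (?ec b)))"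
      "b < dim_col (Matrix.mat (d * (m - 1)) (d * (m - 1)) (\<lambda>(a, b). ?M (?er a) (?ec b)))"
    then have ab: "a < d * (m - 1)" "b < d * (m - 1)" by simp_all
    let ?b = "if b < d * j then b else b + d"
    have dm: "d * m = d * (m - 1) + d" using j by (cases m) simp_all
    have b: "?b < d * m" "b < d * m - d" using ab dm by auto
    \<comment> \<open>Deleting \<open>d\<close> consecutive columns shifts the later ones by exactly
      one block and keeps the position inside the block.\<close>
    have "?b div d = ?h (b div d)" "?b mod d = b mod d"
      using d by (auto simp: div_less_iff_less_mult mult.commute not_less)
    then show "delete_block_col d j (alexander_matrix d G m s r \<phi> \<rho>) $$ (a, b)
        = Matrix.mat (d * (m - 1)) (d * (m - 1)) (\<lambda>(a, b). ?M (?er a) (?ec b)) $$ (a, b)"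
      using ab b d by (simp add: delete_block_col_def alexander_matrix_def Phi del: One_nat_def)
  qed (use j in \<open>simp_all add: delete_block_col_def alexander_matrix_def algebra_simps\<close>)
  have "Determinant.det (delete_block_col d j (alexander_matrix d G m s r \<phi> \<rho>))
      \<simeq> wada_num J P m (\<lambda>p q. group_ring_value G s (fox q (r p))) j"
    unfolding num wada_num_def by (rule idet_enum[OF er ec])
  moreover have "Determinant.det (wada_Phi d G s \<phi> \<rho> (frag_of [(j, True)] - frag_of []))
      \<simeq> wada_den J P (s j)"
  proof -
    have "wada_Phi d G s \<phi> \<rho> (frag_of [(j, True)] - frag_of [])
        = Matrix.mat d d (\<lambda>(a, b). (\<lambda>x y. P (s j) x y - (if x = y then 1 else 0)) (e a) (e b))"
    proof (rule eq_matI)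
      fix a b assume "a < dim_row (Matrix.mat d d (\<lambda>(a, b). (\<lambda>x y. P (s j) x y - (if x = y then 1 else 0)) (e a) (e b)))"
        "b < dim_col (Matrix.mat d d (\<lambda>(a, b). (\<lambda>x y. P (s j) x y - (if x = y then 1 else 0)) (e a) (e b)))"
      then have "a < d" "b < d" by simp_all
      then show "wada_Phi d G s \<phi> \<rho> (frag_of [(j, True)] - frag_of []) $$ (a, b)
        = Matrix.mat d d (\<lambda>(a, b). (\<lambda>x y. P (s j) x y - (if x = y then 1 else 0)) (e a) (e b)) $$ (a, b)"
        using P1[OF eJ eJ] s
        by (simp add: Phi group_ring_value_def frag_extend_diff group_ring_ext_diff word_value_Cons)
    qed (simp_all add: wada_Phi_def group_ring_rep_def)
    then show ?thesis
      unfolding wada_den_def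
      using idet_enum[OF e e, of "\<lambda>x y. P (s j) x y - (if x = y then 1 else 0)"] by simp
  qed
  ultimately show ?thesis
    unfolding twisted_alexander_def wada_def by (rule sgn_eq_divide)
qed

section \<open>Rescaling the variable\<close>

lemma const_ratfun_hom: "comm_ring_hom (const_ratfun :: 'r::idom \<Rightarrow> 'r poly fract)"
  by unfold_locales
    (simp_all add: const_ratfun_def Zero_fract_def One_fract_def mult.commute flip: one_pCons)

lemma const_ratfun_0 [simp]: "const_ratfun (0 :: 'r::idom) = 0"
  and const_ratfun_1 [simp]: "const_ratfun (1 :: 'r) = 1"
  and const_ratfun_mult: "const_ratfun (a * b :: 'r) = const_ratfun a * const_ratfun b"
proof -
  interpret comm_ring_hom "const_ratfun :: 'r \<Rightarrow> 'r poly fract" by (rule const_ratfun_hom)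
  show "const_ratfun (0 :: 'r) = 0" "const_ratfun (1 :: 'r) = 1"
    "const_ratfun (a * b) = const_ratfun a * const_ratfun b"
    by (rule hom_zero hom_one hom_mult)+
qed

lemma t_ratfun_nonzero: "t_ratfun \<noteq> 0"
  by (simp add: t_ratfun_def Zero_fract_def eq_fract)

text \<open>\<open>rescale_var\<close> is defined on the normalised fraction. Any other fraction
  gives the same value, because substitution preserves the cross-multiplied equation, and
  \<open>c\<close> being nonzero keeps denominators nonzero.\<close>

lemma rescale_var_Fract:
  assumes "c \<noteq> 0" "q \<noteq> 0"
  shows "rescale_var c (Fract p q) = Fract (p \<circ>\<^sub>p [:0, c:]) (q \<circ>\<^sub>p [:0, c:])"
proof -
  obtain a b where ab: "quot_of_fract (Fract p q) = (a, b)" by (cases "quot_of_fract (Fract p q)")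
  have b: "b \<noteq> 0" using snd_quot_of_fract_nonzero[of "Fract p q"] ab by simp
  have "Fract a b = Fract p q" using Fract_quot_of_fract[of "Fract p q"] ab by simp
  then have "a * q = p * b" using b assms by (simp add: eq_fract)
  then have "(a \<circ>\<^sub>p [:0, c:]) * (q \<circ>\<^sub>p [:0, c:]) = (p \<circ>\<^sub>p [:0, c:]) * (b \<circ>\<^sub>p [:0, c:])"
    by (simp flip: pcompose_mult)
  then show ?thesis
    using b assms by (simp add: rescale_var_def ab eq_fract pcompose_eq_0_iff)
qed

lemma rescale_var_hom:
  assumes "c \<noteq> 0"
  shows "field_hom (rescale_var c)"
proof -
  have nz: "q \<circ>\<^sub>p [:0, c:] \<noteq> 0" if "q \<noteq> 0" for q
    using assms that by (simp add: pcompose_eq_0_iff)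
  have add: "rescale_var c (x + y) = rescale_var c x + rescale_var c y"
    and mult: "rescale_var c (x * y) = rescale_var c x * rescale_var c y" for x y
  proof -
    obtain a b where x: "x = Fract a b" "b \<noteq> 0" by (cases x)
    obtain a' b' where y: "y = Fract a' b'" "b' \<noteq> 0" by (cases y)
    show "rescale_var c (x + y) = rescale_var c x + rescale_var c y"
      "rescale_var c (x * y) = rescale_var c x * rescale_var c y"
      using x y assms by (simp_all add: rescale_var_Fract nz pcompose_add pcompose_mult)
  qed
  show ?thesis
    by unfold_locales
      (use assms in \<open>simp_all add: add mult Zero_fract_def One_fract_def rescale_var_Fract pcompose_1\<close>)
qed

lemma rescale_var_const: "c \<noteq> 0 \<Longrightarrow> rescale_var c (const_ratfun a) = const_ratfun a"
  by (simp add: const_ratfun_def rescale_var_Fract pcompose_1)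

lemma rescale_var_t: "c \<noteq> 0 \<Longrightarrow> rescale_var c t_ratfun = const_ratfun c * t_ratfun"
  by (simp add: const_ratfun_def t_ratfun_def rescale_var_Fract pcompose_1 pcompose_pCons)

lemma const_ratfun_powi:
  fixes c :: "'r::field"
  shows "const_ratfun (c powi l) = const_ratfun c powi l"
proof (cases "c = 0")
  case True
  then show ?thesis by (simp add: power_int_0_left_if)
next
  case False
  then have inv: "inverse (const_ratfun c) = const_ratfun (inverse c)"
    by (intro inverse_unique) (simp flip: const_ratfun_mult)
  interpret comm_ring_hom "const_ratfun :: 'r \<Rightarrow> 'r poly fract" by (rule const_ratfun_hom)
  show ?thesis
    by (simp add: power_int_def inv hom_power)
qed

lemma rescale_var_powi:
  assumes "c \<noteq> 0"
  shows "rescale_var c (x powi l) = rescale_var c x powi l"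
proof -
  interpret field_hom "rescale_var c" by (rule rescale_var_hom[OF assms])
  show ?thesis by (simp add: power_int_def hom_power hom_inverse)
qed

lemma rescale_var_sgn_eq:
  assumes "c \<noteq> 0" "x \<simeq> y"
  shows "rescale_var c x \<simeq> rescale_var c y"
proof -
  interpret field_hom "rescale_var c" by (rule rescale_var_hom[OF assms(1)])
  show ?thesis using assms(2) by (auto simp: sgn_eq_def hom_uminus)
qed

text \<open>Wada's quotient is a rational expression in the entries of \<open>P\<close>, so a field
  homomorphism may be moved into the entries. There the substitution turns into a twist of the
  representation.\<close>

lemma rescale_var_wada:
  assumes "c \<noteq> 0" "finite J"
  shows "rescale_var c (wada J P m D s j) = wada J (\<lambda>g x y. rescale_var c (P g x y)) m D s j"
proof -
  interpret field_hom "rescale_var c" by (rule rescale_var_hom[OF assms(1)])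
  have "comm_ring_hom (rescale_var c)" by unfold_locales
  then show ?thesis
    unfolding wada_def by (simp add: divide_inverse hom_mult hom_inverse wada_num_hom wada_den_hom assms)
qed

text \<open>At \<open>t = 0\<close> the denominator is \<open>\<plusminus>1\<close>.\<close>

lemma wada_den_nonzero:
  fixes R :: "'g \<Rightarrow> 'i \<Rightarrow> 'i \<Rightarrow> 'r::idom"
  assumes fin: "finite J" and g: "\<phi> g = 1"
  shows "wada_den J (\<lambda>g x y. t_ratfun powi \<phi> g * const_ratfun (R g x y)) g \<noteq> 0"
proof -
  let ?A = "\<lambda>x y. [:0, 1:] * [:R g x y:] - (if x = y then 1 else 0) :: 'r poly"
  have "comm_ring_hom (\<lambda>p. Fract p 1 :: 'r poly fract)"
    by unfold_locales (simp_all add: Zero_fract_def One_fract_def)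
  then have "Fract (idet J J ?A) 1 = idet J J (\<lambda>x y. Fract (?A x y) 1)"
    by (rule idet_hom)
  also have "\<dots> = wada_den J (\<lambda>g x y. t_ratfun powi \<phi> g * const_ratfun (R g x y)) g"
    unfolding wada_den_def
    by (rule idet_cong)
      (use fin g in \<open>auto simp: t_ratfun_def const_ratfun_def One_fract_def\<close>)
  finally have eq: "wada_den J (\<lambda>g x y. t_ratfun powi \<phi> g * const_ratfun (R g x y)) g
      = Fract (idet J J ?A) 1" by simp
  have "comm_ring_hom (\<lambda>p :: 'r poly. poly p 0)"
    by unfold_locales simp_all
  then have "poly (idet J J ?A) 0 = idet J J (\<lambda>x y. poly (?A x y) 0)"
    by (rule idet_hom)
  also have "\<dots> = idet J J (\<lambda>x y. - (if x = y then 1 else 0))"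
    by (rule idet_cong) (use fin in auto)
  also have "\<dots> \<simeq> 1"
    using idet_uminus[of J J "\<lambda>x y. if x = y then 1 else 0"] idet_id[OF fin] by metis
  finally have "idet J J ?A \<noteq> 0" by (auto simp: sgn_eq_def)
  then show ?thesis
    by (simp add: eq Zero_fract_def eq_fract)
qed

section \<open>Roots of unity\<close>

text \<open>The exponent is an integer because values of \<phi> may be negative. The product inside
  \<open>exp\<close> is grouped as in the theorem, so that the final formula follows by
  unfolding.\<close>

definition unity_root :: "nat \<Rightarrow> int \<Rightarrow> complex" where
  "unity_root N a = exp (2 * of_real pi * \<i> / of_nat N * of_int a)"

lemma unity_root_0 [simp]: "unity_root N 0 = 1"
  by (simp add: unity_root_def)

lemma unity_root_nonzero [simp]: "unity_root N a \<noteq> 0"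
  by (simp add: unity_root_def)

lemma unity_root_add: "unity_root N (a + b) = unity_root N a * unity_root N b"
  by (simp add: unity_root_def distrib_left exp_add)

lemma unity_root_minus: "unity_root N (- a) = inverse (unity_root N a)"
  by (simp add: unity_root_def exp_minus)

lemma unity_root_nat_mult: "unity_root N (int m * a) = unity_root N a ^ m"
  by (induction m) (simp_all add: distrib_right unity_root_add)

lemma unity_root_powi: "unity_root N a powi l = unity_root N (a * l)"
proof (cases "l \<ge> 0")
  case True
  then show ?thesis
    using unity_root_nat_mult[of N "nat l" a] by (simp add: power_int_def mult.commute)
next
  case False
  then show ?thesis
    using unity_root_nat_mult[of N "nat (- l)" "- a"]
    by (simp add: power_int_def mult.commute unity_root_minus)
qed

lemma unity_root_eq_1_iff:
  assumes "0 < N"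
  shows "unity_root N a = 1 \<longleftrightarrow> int N dvd a"
proof -
  have "unity_root N a = 1 \<longleftrightarrow> (\<exists>b::int. 2 * pi / real N * of_int a = of_int (2 * b) * pi)"
    by (simp add: unity_root_def exp_eq_1)
  also have "\<dots> \<longleftrightarrow> (\<exists>b::int. real_of_int a = of_int (int N * b))"
    using assms by (intro ex_cong1) (auto simp: field_simps)
  also have "\<dots> \<longleftrightarrow> int N dvd a"
    by (simp only: of_int_eq_iff dvd_def)
  finally show ?thesis .
qed

lemma unity_root_cong:
  assumes "0 < N" "a mod int N = b mod int N"
  shows "unity_root N a = unity_root N b"
proof -
  have "int N dvd a - b" using assms(2) by (simp add: mod_eq_dvd_iff)
  then have "unity_root N (a - b) = 1" using assms(1) by (simp add: unity_root_eq_1_iff)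
  then show ?thesis using unity_root_add[of N "a - b" b] by simp
qed

text \<open>The exponents b + k q run through a coset of C_n in C_kn. The sum is geometric with
  ratio \<open>?x\<close>, an n-th root of unity: either the ratio is 1, or the sum vanishes because
  (1 - x) times it is 1 - x^n = 0.\<close>

lemma sum_unity_root:
  assumes "0 < k" "0 < n"
  shows "(\<Sum>q<n. unity_root (k * n) (a * (b + int k * int q)))
       = (if int n dvd a then of_nat n * unity_root (k * n) (a * b) else 0)"
proof -
  let ?x = "unity_root (k * n) (int k * a)"
  have kn: "0 < k * n" using assms by simp
  have "unity_root (k * n) (a * (b + int k * int q)) = unity_root (k * n) (a * b) * ?x ^ q" for q
    using unity_root_nat_mult[of "k * n" q "int k * a"]
    by (simp add: distrib_left unity_root_add mult_ac)
  then have eq: "(\<Sum>q<n. unity_root (k * n) (a * (b + int k * int q)))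
      = unity_root (k * n) (a * b) * (\<Sum>q<n. ?x ^ q)"
    by (simp add: sum_distrib_left)
  have x1: "?x = 1 \<longleftrightarrow> int n dvd a"
    using unity_root_eq_1_iff[OF kn] assms by simp
  have "?x ^ n = 1"
    using unity_root_eq_1_iff[OF kn, of "int n * (int k * a)"]
    unfolding unity_root_nat_mult by simp
  then have "(1 - ?x) * (\<Sum>q<n. ?x ^ q) = 0"
    by (simp add: sum_gp_strict)
  then show ?thesis
    using x1 by (auto simp: eq)
qed

section \<open>The regular representation of a central extension\<close>

locale cyclic_quotient = group G for G :: "('g, 'b) monoid_scheme" (structure) +
  fixes k n :: nat and \<pi> :: "'g \<Rightarrow> int"
  assumes pos: "0 < k" "0 < n" and finite_carrier: "finite (carrier G)"
    and epi: "\<pi> \<in> epi G (integer_mod_group k)"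
begin

abbreviation Gn :: "('g \<times> int) monoid" where
  "Gn \<equiv> central_extension k n G \<pi>"

lemma \<pi>_hom: "\<pi> \<in> hom G (integer_mod_group k)"
  using epi by (simp add: epi_def)

lemma \<pi>_group_hom: "group_hom G (integer_mod_group k) \<pi>"
  by (intro group_hom.intro group_hom_axioms.intro is_group group_integer_mod_group \<pi>_hom)

lemma \<pi>_range: "z \<in> carrier G \<Longrightarrow> \<pi> z \<in> {0..<int k}"
  using hom_in_carrier[OF \<pi>_hom, of z] pos by (simp add: carrier_integer_mod_group)

lemma carrier_Gn: "(z, l) \<in> carrier Gn \<longleftrightarrow> z \<in> carrier G \<and> l \<in> {0..<int (k * n)} \<and> \<pi> z = l mod int k"
  using pos by (simp add: central_extension_def carrier_integer_mod_group)

lemma mult_Gn: "(z, l) \<otimes>\<^bsub>Gn\<^esub> (z', l') = (z \<otimes> z', (l + l') mod int (k * n))"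
  by (simp add: central_extension_def)

lemma group_Gn: "group Gn"
proof -
  interpret P: group "G \<times>\<times> integer_mod_group (k * n)"
    by (rule DirProd_group) (simp_all add: is_group)
  interpret \<pi>: group_hom G "integer_mod_group k" \<pi>
    by (rule \<pi>_group_hom)
  let ?H = "{(z, l). z \<in> carrier G \<and> l \<in> carrier (integer_mod_group (k * n)) \<and> \<pi> z = l mod int k}"
  have "subgroup ?H (G \<times>\<times> integer_mod_group (k * n))"
  proof (rule P.subgroupI)
    show "?H \<subseteq> carrier (G \<times>\<times> integer_mod_group (k * n))" by auto
    have "(\<one>, 0) \<in> ?H" using \<pi>.hom_one by simp
    then show "?H \<noteq> {}" by blast
  next
    fix a assume "a \<in> ?H"
    then obtain z l where a: "a = (z, l)" "z \<in> carrier G" "l \<in> carrier (integer_mod_group (k * n))"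
      "\<pi> z = l mod int k" by auto
    \<comment> \<open>As k divides kn, reducing modulo kn first does not affect the residue modulo
      k.\<close>
    have "(- (l mod int k)) mod int k = ((- l) mod int (k * n)) mod int k"
      by (simp add: mod_mod_cancel mod_minus_eq)
    moreover have "(- l) mod int (k * n) \<in> carrier (integer_mod_group (k * n))"
      using pos by (simp add: carrier_integer_mod_group)
    ultimately show "inv\<^bsub>G \<times>\<times> integer_mod_group (k * n)\<^esub> a \<in> ?H"
      using a \<pi>.hom_inv[OF a(2)] \<pi>.hom_closed[OF a(2)] by (simp add: is_group)
  next
    fix a b assume "a \<in> ?H" "b \<in> ?H"
    then show "a \<otimes>\<^bsub>G \<times>\<times> integer_mod_group (k * n)\<^esub> b \<in> ?H"
      using pos by (auto simp: \<pi>.hom_mult mod_mod_cancel mod_add_eq carrier_integer_mod_group)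
  qed
  then show ?thesis
    unfolding central_extension_def by (rule P.subgroup_imp_group)
qed

text \<open>On division of \<open>l\<close> by \<open>k\<close>, the remainder is \<pi> z and hence
  determined by \<open>z\<close>; the quotient, which ranges over n values, parametrises the
  fibre.\<close>

lemma bij_betw_Gn:
  "bij_betw (\<lambda>(z, q). (z, \<pi> z + int k * int q)) (carrier G \<times> {..<n}) (carrier Gn)"
proof (rule bij_betw_byWitness[where f' = "\<lambda>(z, l). (z, nat (l div int k))"])
  have less: "\<pi> z + int k * int q < int (k * n)" if "z \<in> carrier G" "q < n" for z q
  proof -
    have "\<pi> z + int k * int q < int k * (int q + 1)"
      using \<pi>_range[OF that(1)] by (simp add: distrib_left)
    also have "\<dots> \<le> int k * int n"
      using that(2) by (intro mult_left_mono) auto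
    finally show ?thesis by simp
  qed
  have div_less: "l div int k < int n" if "l < int k * int n" for l
  proof (rule ccontr)
    assume "\<not> l div int k < int n"
    then have "int k * int n \<le> int k * (l div int k)" by (intro mult_left_mono) auto
    also have "\<dots> \<le> l"
      using minus_mod_eq_mult_div[of l "int k"] pos_mod_sign[of "int k" l] pos by linarith
    finally show False using that by simp
  qed
  show "\<forall>a\<in>carrier G \<times> {..<n}. (\<lambda>(z, l). (z, nat (l div int k))) ((\<lambda>(z, q). (z, \<pi> z + int k * int q)) a) = a"
    using \<pi>_range pos by auto
  show "(\<lambda>(z, q). (z, \<pi> z + int k * int q)) ` (carrier G \<times> {..<n}) \<subseteq> carrier Gn"
    using \<pi>_range less pos by (auto simp: carrier_Gn)
  show "\<forall>a\<in>carrier Gn. (\<lambda>(z, q). (z, \<pi> z + int k * int q)) ((\<lambda>(z, l). (z, nat (l div int k))) a) = a"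
    using pos by (auto simp: carrier_Gn pos_imp_zdiv_nonneg_iff)
  show "(\<lambda>(z, l). (z, nat (l div int k))) ` carrier Gn \<subseteq> carrier G \<times> {..<n}"
    using pos by (auto simp: carrier_Gn nat_less_iff pos_imp_zdiv_nonneg_iff div_less)
qed

lemma finite_Gn: "finite (carrier Gn)" and order_Gn: "order Gn = order G * n"
  using bij_betw_finite[OF bij_betw_Gn] bij_betw_same_card[OF bij_betw_Gn] finite_carrier
  by (simp_all add: order_def card_cartesian_product)

text \<open>Identifies the size of the regular representation with the degree k |H| of the
  theorem.\<close>

lemma order_eq_card_kernel: "order G = k * card (kernel G (integer_mod_group k) \<pi>)"
proof -
  interpret \<pi>: group_hom G "integer_mod_group k" \<pi>
    by (rule \<pi>_group_hom)
  have "\<pi> ` carrier G = carrier (integer_mod_group k)" using epi by (simp add: epi_def)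
  from \<pi>.FactGroup_iso_set[OF this]
  have "card (rcosets (kernel G (integer_mod_group k) \<pi>)) = card (carrier (integer_mod_group k))"
    by (auto simp: iso_def FactGroup_def dest: bij_betw_same_card)
  also have "\<dots> = k" using pos by (simp add: carrier_integer_mod_group)
  finally show ?thesis using lagrange[OF \<pi>.subgroup_kernel] by simp
qed

text \<open>Row \<open>(i, z)\<close> is the vector of \<open>\<complex>[Gn]\<close> supported on the fibre over \<open>z\<close> on which \<open>C\<^sub>n\<close> acts through
  the \<open>c i\<close>-th power of the basic character.\<close>

definition fibre_character :: "int \<Rightarrow> nat \<times> 'g \<Rightarrow> 'g \<times> int \<Rightarrow> complex" where
  "fibre_character c = (\<lambda>(i, z) (z', l). if z = z' then unity_root (k * n) (- (c * int i * l)) else 0)"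

text \<open>The inverse matrix is explicit: \<open>?C'\<close> is the conjugate transpose divided by
  n, and the product is the identity by orthogonality of characters on each fibre. Coprimality makes
  the exponents c i, for i < n, distinct modulo n, so that they give distinct characters of
  C_n.\<close>

lemma idet_fibre_character:
  assumes "coprime c (int n)"
  shows "idet ({..<n} \<times> carrier G) (carrier Gn) (fibre_character c) \<noteq> 0"
proof -
  let ?X = "{..<n} \<times> carrier G"
  let ?C' = "\<lambda>(z', l) (i, z). if z = z' then unity_root (k * n) (c * int i * l) / of_nat n else 0"
  have orth: "(\<Sum>y\<in>carrier Gn. fibre_character c a y * ?C' y b) = (if a = b then 1 else 0)"
    if ab: "a \<in> ?X" "b \<in> ?X" for a b
  proof -
    obtain i z where a: "a = (i, z)" "i < n" "z \<in> carrier G" using ab by auto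
    obtain i' z' where b: "b = (i', z')" "i' < n" "z' \<in> carrier G" using ab by auto
    let ?d = "c * (int i' - int i)"
    have dvd: "int n dvd ?d \<longleftrightarrow> i = i'"
    proof
      assume "int n dvd ?d"
      then have "int n dvd int i' - int i"
        using assms by (simp add: coprime_dvd_mult_right_iff coprime_commute)
      then have "int i' mod int n = int i mod int n" by (simp add: mod_eq_dvd_iff)
      then show "i = i'" using a b by simp
    qed simp
    have "(\<Sum>y\<in>carrier Gn. fibre_character c a y * ?C' y b)
        = (\<Sum>(u, q)\<in>carrier G \<times> {..<n}. fibre_character c a (u, \<pi> u + int k * int q) * ?C' (u, \<pi> u + int k * int q) b)"
      by (subst sum.reindex_bij_betw[OF bij_betw_Gn, symmetric]) (simp add: case_prod_beta)
    also have "\<dots> = (\<Sum>u\<in>carrier G. \<Sum>q<n. fibre_character c a (u, \<pi> u + int k * int q) * ?C' (u, \<pi> u + int k * int q) b)"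
      by (simp add: sum.cartesian_product)
    also have "\<dots> = (\<Sum>u\<in>carrier G. if u = z then if z = z' then
        (\<Sum>q<n. unity_root (k * n) (?d * (\<pi> z + int k * int q))) / of_nat n else 0 else 0)"
    proof (rule sum.cong[OF refl])
      fix u
      have U: "unity_root (k * n) (- (c * int i * l)) * unity_root (k * n) (c * int i' * l)
          = unity_root (k * n) (?d * l)" for l
        unfolding unity_root_add[symmetric] by (simp add: algebra_simps)
      show "(\<Sum>q<n. fibre_character c a (u, \<pi> u + int k * int q) * ?C' (u, \<pi> u + int k * int q) b)
          = (if u = z then if z = z' then (\<Sum>q<n. unity_root (k * n) (?d * (\<pi> z + int k * int q))) / of_nat n else 0 else 0)"
        by (auto simp: a b fibre_character_def sum_divide_distrib U)
    qed
    also have "\<dots> = (if z = z' then (\<Sum>q<n. unity_root (k * n) (?d * (\<pi> z + int k * int q))) / of_nat n else 0)"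
      using finite_carrier a by (simp add: sum.delta)
    also have "\<dots> = (if a = b then 1 else 0)"
      unfolding sum_unity_root[OF pos] dvd using pos by (auto simp: a b)
    finally show ?thesis .
  qed
  have card: "card ?X = card (carrier Gn)"
    using order_Gn by (simp add: order_def card_cartesian_product)
  have "idet ?X (carrier Gn) (fibre_character c) * idet (carrier Gn) ?X ?C'
      = idet ?X ?X (\<lambda>a b. \<Sum>y\<in>carrier Gn. fibre_character c a y * ?C' y b)"
    using finite_Gn card by (intro idet_mult) simp_all
  also have "\<dots> = idet ?X ?X (\<lambda>a b. if a = b then 1 else 0)"
    by (rule idet_cong) (use finite_carrier orth in auto)
  also have "\<dots> = 1" using finite_carrier by (intro idet_id) simp
  finally show ?thesis by auto
qed

text \<open>Only y = w (z0, l0)^(-1) contributes, and its second component is l' - l0 modulo kn,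
  where l' is that of \<open>w\<close>. With the minus sign in the exponent of
  \<open>fibre_character\<close>, this separates off a factor with the positive exponent c i
  l0.\<close>

lemma fibre_character_intertwine:
  assumes g: "(z0, l0) \<in> carrier Gn" and x: "i < n" "z \<in> carrier G" and w: "w \<in> carrier Gn"
  shows "(\<Sum>y\<in>carrier Gn. fibre_character c (i, z) y * (if y \<otimes>\<^bsub>Gn\<^esub> (z0, l0) = w then 1 else 0))
       = unity_root (k * n) (c * int i * l0) * fibre_character c (i, z \<otimes> z0) w"
proof -
  interpret Gn: group Gn by (rule group_Gn)
  obtain z' l' where w': "w = (z', l')" by (cases w)
  obtain u l where ul: "w \<otimes>\<^bsub>Gn\<^esub> inv\<^bsub>Gn\<^esub> (z0, l0) = (u, l)" by (cases "w \<otimes>\<^bsub>Gn\<^esub> inv\<^bsub>Gn\<^esub> (z0, l0)")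
  have ulG: "(u, l) \<in> carrier Gn" using w g by (simp flip: ul)
  have "(u, l) \<otimes>\<^bsub>Gn\<^esub> (z0, l0) = w" using w g by (simp add: Gn.m_assoc flip: ul)
  then have z': "u \<otimes> z0 = z'" and l': "l' = (l + l0) mod int (k * n)"
    by (simp_all add: w' mult_Gn)
  have u: "u \<in> carrier G" "z0 \<in> carrier G" using ulG g by (simp_all add: carrier_Gn)
  have "(y \<otimes>\<^bsub>Gn\<^esub> (z0, l0) = w) = (y = (u, l))" if "y \<in> carrier Gn" for y
    using that w g ul by (metis Gn.inv_solve_right)
  then have "(\<Sum>y\<in>carrier Gn. fibre_character c (i, z) y * (if y \<otimes>\<^bsub>Gn\<^esub> (z0, l0) = w then 1 else 0))
      = (\<Sum>y\<in>carrier Gn. if y = (u, l) then fibre_character c (i, z) (u, l) else 0)"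
    by (intro sum.cong) auto
  also have "\<dots> = fibre_character c (i, z) (u, l)"
    using finite_Gn ulG by (simp add: sum.delta)
  also have "\<dots> = unity_root (k * n) (c * int i * l0) * fibre_character c (i, z \<otimes> z0) w"
  proof (cases "z = u")
    case True
    \<comment> \<open>\<open>l\<close> and \<open>l' - l0\<close> agree only modulo kn, which is all
      that the root of unity depends on.\<close>
    have "l + l0 = l' + int (k * n) * ((l + l0) div int (k * n))"
      unfolding l' by (rule mod_mult_div_eq[symmetric])
    then obtain q where q: "l = l' - l0 + int (k * n) * q"
      by (metis add_diff_cancel_right' add_diff_eq add.commute)
    have "- (c * int i * l) = c * int i * l0 + - (c * int i * l') + int (k * n) * (- (c * int i * q))"
      unfolding q by (simp add: algebra_simps)
    then have "(- (c * int i * l)) mod int (k * n) = (c * int i * l0 + - (c * int i * l')) mod int (k * n)"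
      by (simp only: mod_mult_self2)
    then have "unity_root (k * n) (- (c * int i * l))
        = unity_root (k * n) (c * int i * l0) * unity_root (k * n) (- (c * int i * l'))"
      unfolding unity_root_add[symmetric] using pos by (intro unity_root_cong) simp_all
    then show ?thesis
      using True z' by (simp add: fibre_character_def w')
  next
    case False
    then have "z \<otimes> z0 \<noteq> z'" using z' u x right_cancel[of z0 z u] by auto
    with False show ?thesis by (simp add: fibre_character_def w')
  qed
  finally show ?thesis .
qed

end

text \<open>Commutators die in \<open>A\<close>, so \<open>h\<close> is trivial on the kernel of
  \<phi>, and g x^(-\<phi>(g)) lies in that kernel. Applied to the C_kn component of
  \<open>f\<close>, this determines it from its value on a single meridian.\<close>

lemma hom_abelian_factors:
  assumes "group G" "\<phi> \<in> hom G integer_group" "kernel G integer_group \<phi> = derived G (carrier G)"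
    and h: "h \<in> hom G A" "comm_group A"
    and x: "x \<in> carrier G" "\<phi> x = 1" and g: "g \<in> carrier G"
  shows "h g = h x [^]\<^bsub>A\<^esub> \<phi> g"
proof -
  interpret G: group G by fact
  interpret A: comm_group A by fact
  interpret h: group_hom G A h
    by (intro group_hom.intro group_hom_axioms.intro G.is_group A.is_group h(1))
  interpret \<phi>: group_hom G integer_group \<phi>
    by (intro group_hom.intro group_hom_axioms.intro G.is_group group_integer_group assms(2))
  have "derived G (carrier G) \<subseteq> kernel G A h"
    unfolding derived_def
  proof (rule G.generate_subgroup_incl[OF _ h.subgroup_kernel], clarify)
    fix a b assume ab: "a \<in> carrier G" "b \<in> carrier G"
    have "h a \<otimes>\<^bsub>A\<^esub> h b \<otimes>\<^bsub>A\<^esub> inv\<^bsub>A\<^esub> h a \<otimes>\<^bsub>A\<^esub> inv\<^bsub>A\<^esub> h b = \<one>\<^bsub>A\<^esub>"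
      using ab by (simp add: A.m_comm[of "h a" "h b"] A.m_assoc)
    then show "a \<otimes>\<^bsub>G\<^esub> b \<otimes>\<^bsub>G\<^esub> inv\<^bsub>G\<^esub> a \<otimes>\<^bsub>G\<^esub> inv\<^bsub>G\<^esub> b \<in> kernel G A h"
      using ab by (simp add: kernel_def)
  qed
  moreover have "g \<otimes>\<^bsub>G\<^esub> inv\<^bsub>G\<^esub> (x [^]\<^bsub>G\<^esub> \<phi> g) \<in> kernel G integer_group \<phi>"
    using x g by (simp add: kernel_def \<phi>.hom_int_pow)
  ultimately have "g \<otimes>\<^bsub>G\<^esub> inv\<^bsub>G\<^esub> (x [^]\<^bsub>G\<^esub> \<phi> g) \<in> kernel G A h"
    using assms(3) by blast
  then have "h g \<otimes>\<^bsub>A\<^esub> inv\<^bsub>A\<^esub> (h x [^]\<^bsub>A\<^esub> \<phi> g) = \<one>\<^bsub>A\<^esub>"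
    using x g by (simp add: kernel_def h.hom_int_pow)
  then show ?thesis
    using x g by (simp add: A.inv_solve_right' )
qed

text \<open>In the matrix product only z = x F(g) survives, and the powers of t multiply because
  \<phi> is additive. The lemma serves both regular representations, with \<open>F\<close> being
  \<open>f\<close> or its first component.\<close>

lemma regular_group_matrix_rep:
  fixes A :: "('a, 'c) monoid_scheme"
  assumes "group G" "group A" "finite (carrier A)" and F: "F \<in> hom G A"
    and \<phi>: "\<phi> \<in> hom G integer_group"
  shows "group_matrix_rep G (carrier A)
     (\<lambda>g x y. t_ratfun powi \<phi> g * const_ratfun (if x \<otimes>\<^bsub>A\<^esub> F g = y then 1 else 0 :: 'r::idom))"
proof -
  interpret G: group G by fact
  interpret A: group A by fact
  interpret F: group_hom G A F
    by (intro group_hom.intro group_hom_axioms.intro G.is_group A.is_group F)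
  interpret \<phi>: group_hom G integer_group \<phi>
    by (intro group_hom.intro group_hom_axioms.intro G.is_group group_integer_group \<phi>)
  let ?c = "\<lambda>b. const_ratfun (if b then 1 else 0 :: 'r)"
  show ?thesis
  proof (unfold_locales, goal_cases)
    case (2 x y)
    then show ?case using \<phi>.hom_one by simp
  next
    case (3 g h x y)
    have "(\<Sum>z\<in>carrier A. (t_ratfun powi \<phi> g * ?c (x \<otimes>\<^bsub>A\<^esub> F g = z)) * (t_ratfun powi \<phi> h * ?c (z \<otimes>\<^bsub>A\<^esub> F h = y)))
        = (\<Sum>z\<in>carrier A. if z = x \<otimes>\<^bsub>A\<^esub> F g
            then t_ratfun powi \<phi> g * t_ratfun powi \<phi> h * ?c (x \<otimes>\<^bsub>A\<^esub> F g \<otimes>\<^bsub>A\<^esub> F h = y) else 0)"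
      by (intro sum.cong) auto
    also have "\<dots> = t_ratfun powi \<phi> g * t_ratfun powi \<phi> h * ?c (x \<otimes>\<^bsub>A\<^esub> F g \<otimes>\<^bsub>A\<^esub> F h = y)"
      using 3 assms(3) by (simp add: sum.delta)
    also have "\<dots> = t_ratfun powi \<phi> (g \<otimes>\<^bsub>G\<^esub> h) * ?c (x \<otimes>\<^bsub>A\<^esub> F (g \<otimes>\<^bsub>G\<^esub> h) = y)"
      using 3 \<phi>.hom_mult[of g h] by (simp add: power_int_add t_ratfun_nonzero A.m_assoc)
    finally show ?case by simp
  qed (fact assms(3))
qed

lemma sgn_eq_imp_eq_up_to_units:
  fixes F G :: "'r::idom poly fract"
  assumes "F \<simeq> G"
  shows "eq_up_to_units F G"
proof -
  interpret comm_ring_hom "const_ratfun :: 'r \<Rightarrow> 'r poly fract" by (rule const_ratfun_hom)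
  have "const_ratfun (- 1 :: 'r) = - 1" by (simp add: hom_uminus)
  then have "F = const_ratfun 1 * t_ratfun powi 0 * G \<or> F = const_ratfun (- 1) * t_ratfun powi 0 * G"
    using assms by (simp add: sgn_eq_def)
  then show ?thesis
  proof
    assume "F = const_ratfun 1 * t_ratfun powi 0 * G"
    then show ?thesis
      unfolding eq_up_to_units_def by (intro exI[of _ 1] exI[of _ 0]) simp
  next
    assume "F = const_ratfun (- 1) * t_ratfun powi 0 * G"
    then show ?thesis
      unfolding eq_up_to_units_def by (intro exI[of _ "- 1"] exI[of _ 0]) simp
  qed
qed

section \<open>The theorem\<close>

theorem theorem1p3:
  fixes k n m j j' :: nat
    and G1 :: "('g, 'b) monoid_scheme" and \<pi> :: "'g \<Rightarrow> int"
    and e1 :: "nat \<Rightarrow> 'g" and en :: "nat \<Rightarrow> 'g \<times> int"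
    and K :: "real \<Rightarrow> real ^ 4" and T :: "real \<times> complex \<Rightarrow> real ^ 4" and x0 :: "real ^ 4"
    and \<phi> :: "(real \<Rightarrow> real ^ 4) set \<Rightarrow> int"
    and s :: "nat \<Rightarrow> (real \<Rightarrow> real ^ 4) set" and r :: "nat \<Rightarrow> letter list"
    and f :: "(real \<Rightarrow> real ^ 4) set \<Rightarrow> 'g \<times> int"
  defines "H \<equiv> derived G1 (carrier G1)"
    and "Gn \<equiv> central_extension k n G1 \<pi>"
    and "GK \<equiv> knot_group T x0"
  defines "\<rho>1 \<equiv> \<lambda>g. (map_mat of_int (regular_rep G1 e1 g) :: complex mat)"
    and "\<rho>n \<equiv> \<lambda>g. (map_mat of_int (regular_rep Gn en g) :: complex mat)"
  assumes "0 < k" and "0 < n"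
    and "group G1" and "finite (carrier G1)"
    and "is_abelianization G1 (integer_mod_group k) \<pi>"
    and "bij_betw e1 {..<order G1} (carrier G1)"
    and "bij_betw en {..<order Gn} (carrier Gn)"
    and "oriented_knot K" and "tubular_neighbourhood K T" and "x0 \<in> knot_exterior T"
    and "knot_abelianization T x0 \<phi>"
    and "wirtinger_presentation T x0 m s r" and "j < m" and "j' < m"
    and "f \<in> epi GK Gn"
  shows "eq_up_to_units
           (twisted_alexander (k * n * card H) GK m s r \<phi> (\<rho>n \<circ> f) j)
           (\<Prod>i<n. rescale_var (exp (2 * of_real pi * \<i> / of_nat (k * n) * of_nat i))
                     (twisted_alexander (k * card H) GK m s r \<phi> (\<rho>1 \<circ> fst \<circ> f) j'))"
proof -
  let ?N = "k * n"
  have N: "0 < ?N" using \<open>0 < k\<close> \<open>0 < n\<close> by simp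
  have ab: "\<pi> \<in> epi G1 (integer_mod_group k)" "kernel G1 (integer_mod_group k) \<pi> = H"
    using \<open>is_abelianization G1 (integer_mod_group k) \<pi>\<close> by (simp_all add: is_abelianization_def H_def)
  interpret G1: cyclic_quotient G1 k n \<pi>
    by (intro cyclic_quotient.intro cyclic_quotient_axioms.intro ab assms)
  interpret Gn: group Gn
    unfolding Gn_def by (rule G1.group_Gn)
  interpret GK: group GK
    unfolding GK_def knot_group_def by (rule group_fundamental_group) fact
  have order1: "order G1 = k * card H"
    using G1.order_eq_card_kernel ab by simp
  have ordern: "order Gn = k * n * card H"
    using G1.order_Gn order1 by (simp add: Gn_def mult_ac)
  have pos: "0 < k * card H" "0 < k * n * card H"
    using order1 ordern G1.order_gt_0_iff_finite G1.finite_carrier G1.finite_Gn Gn.order_gt_0_iff_finite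
    by (simp_all add: Gn_def)

  have \<phi>: "\<phi> \<in> hom GK integer_group" "kernel GK integer_group \<phi> = derived GK (carrier GK)"
    and mer: "\<And>c. oriented_meridian T x0 c \<Longrightarrow> \<phi> c = 1"
    using \<open>knot_abelianization T x0 \<phi>\<close>
    by (simp_all add: knot_abelianization_def is_abelianization_def epi_def GK_def)
  have wp: "\<And>i. i < m \<Longrightarrow> oriented_meridian T x0 (s i)" "group_presentation GK m s (m - 1) r"
    using \<open>wirtinger_presentation T x0 m s r\<close> by (simp_all add: wirtinger_presentation_def GK_def)
  have s: "s ` {..<m} \<subseteq> carrier GK" and s1: "\<And>i. i < m \<Longrightarrow> \<phi> (s i) = 1"
    using wp mer by (simp_all add: group_presentation_def)
  have r: "fst ` set (r p) \<subseteq> {..<m}" "word_value GK s (r p) = \<one>\<^bsub>GK\<^esub>" if "p < m - 1" for p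
  proof -
    have "r p \<in> carrier (free_group m)"
      using wp(2) that by (auto simp: group_presentation_def)
    then show "fst ` set (r p) \<subseteq> {..<m}" by (simp add: free_group_def)
    have "r p \<in> normal_closure (free_group m) (r ` {..<m - 1})"
      using that by (auto simp: normal_closure_def)
    then have "r p \<in> kernel (free_group m) GK (word_value GK s)"
      using wp(2) by (simp add: group_presentation_def)
    then show "word_value GK s (r p) = \<one>\<^bsub>GK\<^esub>" by (simp add: kernel_def)
  qed

  have f: "f \<in> hom GK Gn" "f ` carrier GK = carrier Gn"
    using \<open>f \<in> epi GK Gn\<close> by (simp_all add: epi_def)
  have fG: "f g \<in> carrier Gn" if "g \<in> carrier GK" for g
    using f that by (auto simp: hom_def)
  have f_mult: "f (g \<otimes>\<^bsub>GK\<^esub> h) = f g \<otimes>\<^bsub>Gn\<^esub> f h" if "g \<in> carrier GK" "h \<in> carrier GK" for g h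
    using f that by (auto simp: hom_def)
  have fst_hom: "fst \<circ> f \<in> hom GK G1"
  proof (rule homI)
    fix g assume "g \<in> carrier GK"
    then show "(fst \<circ> f) g \<in> carrier G1"
      using fG[of g] by (cases "f g") (simp add: Gn_def G1.carrier_Gn)
  next
    fix g h assume "g \<in> carrier GK" "h \<in> carrier GK"
    then show "(fst \<circ> f) (g \<otimes>\<^bsub>GK\<^esub> h) = (fst \<circ> f) g \<otimes>\<^bsub>G1\<^esub> (fst \<circ> f) h"
      using f_mult[of g h] by (cases "f g"; cases "f h") (simp add: Gn_def G1.mult_Gn)
  qed
  have snd_hom: "snd \<circ> f \<in> hom GK (integer_mod_group ?N)"
  proof (rule homI)
    fix g assume "g \<in> carrier GK"
    then show "(snd \<circ> f) g \<in> carrier (integer_mod_group ?N)"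
      using fG[of g] N by (cases "f g") (simp add: Gn_def G1.carrier_Gn carrier_integer_mod_group)
  next
    fix g h assume "g \<in> carrier GK" "h \<in> carrier GK"
    then show "(snd \<circ> f) (g \<otimes>\<^bsub>GK\<^esub> h) = (snd \<circ> f) g \<otimes>\<^bsub>integer_mod_group ?N\<^esub> (snd \<circ> f) h"
      using f_mult[of g h] by (cases "f g"; cases "f h") (simp add: Gn_def G1.mult_Gn)
  qed
  define c where "c = snd (f (s j))"
  have snd_f: "snd (f g) = (\<phi> g * c) mod int ?N" if "g \<in> carrier GK" for g
    using hom_abelian_factors[OF GK.is_group \<phi> snd_hom abelian_integer_mod_group _ s1[OF \<open>j < m\<close>] that]
      s \<open>j < m\<close> by (auto simp: int_pow_integer_mod_group c_def)

  text \<open>Meridians need not map to the generator of \<open>C\<^sub>k\<^sub>n\<close>, only to \<open>x\<^sup>c\<close>. As \<open>f\<close> is onto, \<open>c\<close> is a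
    unit modulo \<open>k n\<close>, and its inverse \<open>c'\<close> renormalises the characters.\<close>
  obtain c' where c': "(c' * c) mod int ?N = 1 mod int ?N"
  proof -
    \<comment> \<open>The witness for \<open>c'\<close> is \<phi> g, where \<open>f\<close> maps g
      to an element lying over the generator x of C_kn. Residues are written
      \<open>1 mod ...\<close> since in a group of order 1 the generator is 0.\<close>
    have "1 mod int k \<in> \<pi> ` carrier G1"
      using ab(1) \<open>0 < k\<close> by (simp add: epi_def carrier_integer_mod_group)
    then obtain z where z: "z \<in> carrier G1" "\<pi> z = 1 mod int k" by auto
    then have "(z, 1 mod int ?N) \<in> carrier Gn"
      using N by (simp add: Gn_def G1.carrier_Gn mod_mod_cancel)
    then obtain g where "g \<in> carrier GK" "f g = (z, 1 mod int ?N)"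
      using f(2) by (metis imageE)
    then show ?thesis using snd_f[of g] that by simp
  qed
  have coprime: "coprime c' (int n)"
  proof (rule coprimeI)
    fix d assume d: "d dvd c'" "d dvd int n"
    have "int ?N dvd c' * c - 1" using c' by (simp add: mod_eq_dvd_iff)
    then have "d dvd c' * c - 1" using d(2) by (metis dvd_trans dvd_triv_right of_nat_mult)
    moreover have "d dvd c' * c" using d(1) by simp
    ultimately have "d dvd c' * c - (c' * c - 1)" by (rule dvd_diff[rotated])
    then show "is_unit d" by simp
  qed
  \<comment> \<open>The second component of f g is c \<phi>(g) modulo kn, and multiplying the
    exponent by \<open>c'\<close> cancels c. Thus the i-th character, after renormalisation, sees
    \<phi> g itself.\<close>
  have root: "unity_root ?N (c' * int i * snd (f g)) = unity_root ?N (int i * \<phi> g)"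
    if "g \<in> carrier GK" for i g
  proof (rule unity_root_cong[OF N])
    have "(c' * int i * snd (f g)) mod int ?N = (c' * int i * (\<phi> g * c)) mod int ?N"
      unfolding snd_f[OF that] by (rule mod_mult_right_eq)
    also have "c' * int i * (\<phi> g * c) = int i * \<phi> g * (c' * c)" by simp
    also have "(int i * \<phi> g * (c' * c)) mod int ?N = (int i * \<phi> g * 1) mod int ?N"
      using c' by (rule mod_mult_cong[OF refl])
    finally show "(c' * int i * snd (f g)) mod int ?N = (int i * \<phi> g) mod int ?N" by simp
  qed

  let ?c = "const_ratfun :: complex \<Rightarrow> complex poly fract"
  let ?D = "\<lambda>p q. group_ring_value GK s (fox q (r p))"
  define P1 where "P1 = (\<lambda>g x y. t_ratfun powi \<phi> g * ?c (if x \<otimes>\<^bsub>G1\<^esub> (fst \<circ> f) g = y then 1 else 0))"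
  define Pn where "Pn = (\<lambda>g x y. t_ratfun powi \<phi> g * ?c (if x \<otimes>\<^bsub>Gn\<^esub> f g = y then 1 else 0))"
  \<comment> \<open>Over the knot group the i-th isotypic part is \<open>P1\<close> with t replaced
    by zeta^i t: the factor zeta^(i \<phi>(g)) of the twist is what t^\<phi>(g) acquires under this
    substitution.\<close>
  define Q where "Q = (\<lambda>i :: nat. \<lambda>g x y. rescale_var (unity_root ?N (int i)) (P1 g x y))"
  let ?Qs = "\<lambda>g (i, x) (i', y). if i = i' then Q i g x y else 0"
  let ?X = "{..<n} \<times> carrier G1"
  interpret P1: group_matrix_rep GK "carrier G1" P1
    unfolding P1_def
    by (rule regular_group_matrix_rep[OF GK.is_group G1.is_group G1.finite_carrier fst_hom \<phi>(1)])
  have finite_Gn: "finite (carrier Gn)" unfolding Gn_def by (rule G1.finite_Gn)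
  interpret Pn: group_matrix_rep GK "carrier Gn" Pn
    unfolding Pn_def
    by (rule regular_group_matrix_rep[OF GK.is_group Gn.is_group finite_Gn f(1) \<phi>(1)])

  have Q: "Q i g x y = t_ratfun powi \<phi> g
      * ?c (unity_root ?N (int i * \<phi> g) * (if x \<otimes>\<^bsub>G1\<^esub> fst (f g) = y then 1 else 0))" for i g x y
  proof -
    interpret field_hom "rescale_var (unity_root ?N (int i))" by (rule rescale_var_hom) simp
    show ?thesis
      by (simp add: Q_def P1_def hom_mult rescale_var_powi rescale_var_const rescale_var_t
          power_int_mult_distrib const_ratfun_mult unity_root_powi mult_ac flip: const_ratfun_powi)
  qed
  define C where "C = (\<lambda>a b. ?c (G1.fibre_character c' a b))"
  have idet_C: "idet ?X (carrier Gn) C \<noteq> 0"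
  proof -
    have "idet ?X (carrier Gn) C = ?c (idet ?X (carrier Gn) (G1.fibre_character c'))"
      unfolding C_def by (rule idet_hom[OF const_ratfun_hom, symmetric])
    then show ?thesis
      using G1.idet_fibre_character[OF coprime]
      by (simp add: Gn_def const_ratfun_def Zero_fract_def eq_fract)
  qed
  have tw: "(\<Sum>y\<in>carrier Gn. C a y * Pn g y w) = (\<Sum>b\<in>?X. ?Qs g a b * C b w)"
    if g: "g \<in> carrier GK" and a: "a \<in> ?X" and w: "w \<in> carrier Gn" for g a w
  proof -
    interpret c: comm_ring_hom ?c by (rule const_ratfun_hom)
    obtain i z where iz: "a = (i, z)" "i < n" "z \<in> carrier G1" using a by auto
    obtain z0 l0 where fg: "f g = (z0, l0)" by (cases "f g")
    have z0: "z0 \<in> carrier G1" using fG[OF g] by (simp add: fg Gn_def G1.carrier_Gn)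
    let ?u = "unity_root ?N (int i * \<phi> g)"
    have "(\<Sum>y\<in>carrier Gn. C a y * Pn g y w) = t_ratfun powi \<phi> g * ?c (\<Sum>y\<in>carrier Gn.
        G1.fibre_character c' a y * (if y \<otimes>\<^bsub>Gn\<^esub> f g = w then 1 else 0))"
      by (simp only: C_def Pn_def c.hom_sum sum_distrib_left const_ratfun_mult mult_ac)
    also have "\<dots> = t_ratfun powi \<phi> g * ?c (?u * G1.fibre_character c' (i, z \<otimes>\<^bsub>G1\<^esub> z0) w)"
      using G1.fibre_character_intertwine[of z0 l0 i z w c'] fG[OF g] root[OF g, of i] iz w
      by (simp add: fg Gn_def)
    also have "\<dots> = (\<Sum>b\<in>?X. if b = (i, z \<otimes>\<^bsub>G1\<^esub> z0)
        then t_ratfun powi \<phi> g * ?c ?u * C (i, z \<otimes>\<^bsub>G1\<^esub> z0) w else 0)"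
      using iz z0 G1.finite_carrier by (simp add: sum.delta C_def const_ratfun_mult)
    also have "\<dots> = (\<Sum>b\<in>?X. ?Qs g a b * C b w)"
      by (intro sum.cong) (auto simp: iz Q fg split: if_splits)
    finally show ?thesis .
  qed
  have fin: "finite ?X" and card: "card ?X = card (carrier Gn)"
    using G1.finite_carrier G1.order_Gn by (simp_all add: card_cartesian_product order_def Gn_def)
  have keys: "Poly_Mapping.keys (?D p q) \<subseteq> carrier GK" if "p < m - 1" for p q
    by (rule GK.keys_group_ring_value_fox[OF s r(1)[OF that]])
  have sj: "s j \<in> carrier GK" "s j' \<in> carrier GK" using s \<open>j < m\<close> \<open>j' < m\<close> by auto

  have "twisted_alexander (k * n * card H) GK m s r \<phi> (\<rho>n \<circ> f) j \<simeq> wada (carrier Gn) Pn m ?D s j"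
    unfolding Pn_def
  proof (rule GK.twisted_alexander_eq_wada[where e = en])
    show "bij_betw en {..<k * n * card H} (carrier Gn)"
      using \<open>bij_betw en {..<order Gn} (carrier Gn)\<close> by (simp only: ordern)
    show "(\<rho>n \<circ> f) g $$ (a, b) = (if en a \<otimes>\<^bsub>Gn\<^esub> f g = en b then 1 else 0)"
      if "a < k * n * card H" "b < k * n * card H" for g a b
      using that by (simp add: \<rho>n_def regular_rep_def ordern)
  qed (use pos \<open>j < m\<close> sj Pn.rep_one in \<open>simp_all add: Pn_def\<close>)
  also have "wada (carrier Gn) Pn m ?D s j \<simeq> wada ?X ?Qs m ?D s j"
    unfolding wada_def
  proof (rule sgn_eq_divide)
    show "wada_num (carrier Gn) Pn m ?D j \<simeq> wada_num ?X ?Qs m ?D j"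
    proof (rule wada_num_intertwine[where C = C and S = "carrier GK"])
      show "Poly_Mapping.keys (?D p q) \<subseteq> carrier GK" if "p < m - 1" for p q
        by (rule keys[OF that])
      show "(\<Sum>y\<in>carrier Gn. C a y * Pn g y w) = (\<Sum>b\<in>?X. ?Qs g a b * C b w)"
        if "g \<in> carrier GK" "a \<in> ?X" "w \<in> carrier Gn" for g a w
        by (rule tw[OF that])
    qed (fact fin finite_Gn card idet_C \<open>j < m\<close>)+
    have "wada_den (carrier Gn) Pn (s j) = wada_den ?X ?Qs (s j)"
      by (rule wada_den_intertwine[where C = C and P = Pn and P' = ?Qs])
        (fact fin finite_Gn card idet_C tw[OF sj(1)])+
    then show "wada_den (carrier Gn) Pn (s j) \<simeq> wada_den ?X ?Qs (s j)" by simp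
  qed
  also have "wada ?X ?Qs m ?D s j \<simeq> (\<Prod>i<n. wada (carrier G1) (Q i) m ?D s j)"
    by (rule wada_direct_sum[OF finite_lessThan G1.finite_carrier \<open>j < m\<close>])
  also have "(\<Prod>i<n. wada (carrier G1) (Q i) m ?D s j)
      = (\<Prod>i<n. rescale_var (unity_root ?N (int i)) (wada (carrier G1) P1 m ?D s j))"
    unfolding Q_def by (simp add: rescale_var_wada G1.finite_carrier)
  also have "\<dots> \<simeq> (\<Prod>i<n. rescale_var (unity_root ?N (int i))
      (twisted_alexander (k * card H) GK m s r \<phi> (\<rho>1 \<circ> fst \<circ> f) j'))"
  proof (intro sgn_eq_prod rescale_var_sgn_eq unity_root_nonzero)
    \<comment> \<open>The two sides of the theorem may delete different generators. Passing from the
      cross-multiplied relation to quotients requires both denominators to be nonzero, which holds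
      since meridians have degree 1 in t.\<close>
    have den: "wada_den (carrier G1) P1 (s j) \<noteq> 0" "wada_den (carrier G1) P1 (s j') \<noteq> 0"
      unfolding P1_def
      by (rule wada_den_nonzero[where \<phi> = \<phi>, OF G1.finite_carrier];
          use s1 \<open>j < m\<close> \<open>j' < m\<close> in simp)+
    have "wada_num (carrier G1) P1 m ?D j * wada_den (carrier G1) P1 (s j')
        \<simeq> wada_num (carrier G1) P1 m ?D j' * wada_den (carrier G1) P1 (s j)"
      by (rule P1.wada_change_generator[OF s \<open>j < m\<close> \<open>j' < m\<close> r])
    then have "wada (carrier G1) P1 m ?D s j \<simeq> wada (carrier G1) P1 m ?D s j'"
      using den by (auto simp: wada_def sgn_eq_def field_simps)
    also have "\<dots> \<simeq> twisted_alexander (k * card H) GK m s r \<phi> (\<rho>1 \<circ> fst \<circ> f) j'"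
      unfolding P1_def
    proof (rule sgn_eq_sym, rule GK.twisted_alexander_eq_wada[where e = e1])
      show "bij_betw e1 {..<k * card H} (carrier G1)"
        using \<open>bij_betw e1 {..<order G1} (carrier G1)\<close> by (simp only: order1)
      show "(\<rho>1 \<circ> fst \<circ> f) g $$ (a, b) = (if e1 a \<otimes>\<^bsub>G1\<^esub> (fst \<circ> f) g = e1 b then 1 else 0)"
        if "a < k * card H" "b < k * card H" for g a b
        using that by (simp add: \<rho>1_def regular_rep_def order1)
    qed (use pos \<open>j' < m\<close> sj P1.rep_one in \<open>simp_all add: P1_def\<close>)
    finally show "wada (carrier G1) P1 m ?D s j
        \<simeq> twisted_alexander (k * card H) GK m s r \<phi> (\<rho>1 \<circ> fst \<circ> f) j'" .
  qed
  finally show ?thesis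
    unfolding unity_root_def of_int_of_nat_eq by (rule sgn_eq_imp_eq_up_to_units)
qed

end
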